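(* For integers $m\ge 1$ and $k$, let $n_{m,k}=(-1)^mN_{m,k}(1)$, where $N_{m,k}(1)$ is the coefficient of $q^{k/2}$ in $$f_{m}^{1}(q)=(q^{1/2}-q^{-1/2})\,[x^m]\,\mathrm{Log}\left(\sum_{n\geq 0}\frac{q^{\frac{n(n-1)}{2}+\frac{n^2}{2}}}{(1-q)(1-q^2)\cdots(1-q^n)}x^n\right),$$ and put $g_m(q)=\sum_{k\in\mathbb{Z}}n_{m,k}q^k$. Then for any $m\ge 1$, $$g_m(1)=\sum_{k}n_{m,k}=(-1)^m f_m^1(1)\in\mathbb{Z}.$$
   Context: For a power series $F$ in $x$ with constant term $1$ and coefficients rational functions of $q^{1/2}$, the plethystic logarithm is $$\mathrm{Log}(F)=\sum_{d\ge 1}\frac{\mu(d)}{d}\Psi_d(\log F),$$ where $\mu$ is the Möbius function and $\Psi_d$ is the $\mathbb{Q}$-algebra map replacing $x$ by $x^d$ and $q$ by $q^d$ (so $q^{1/2}$ by $q^{d/2}$). $[x^m]G$ denotes the coefficient of $x^m$ in $G$. The numbers $N_{m,k}(1)$ are defined by $f_m^1(q)=\sum_{k\in\mathbb{Z}}N_{m,k}(1)q^{k/2}$, and $f_m^1(1)$ denotes the value of $f_m^1(q)$ at $q=1$. *)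

theory Defs
  imports
    "HOL-Computational_Algebra.Computational_Algebra"
    "HOL-Computational_Algebra.Field_as_Ring"
begin

text \<open>
  Rational functions of $q^{1/2}$ over the rationals are elements of the fraction field of
  \<^typ>\<open>rat poly\<close>; the polynomial variable stands for $q^{1/2}$.
\<close>

type_synonym ratfun = "rat poly fract"

definition qhalf :: ratfun where
  "qhalf = to_fract [:0, 1:]"

definition q :: ratfun where
  "q = qhalf ^ 2"

text \<open>
  \<^const>\<open>quot_of_fract\<close> yields the fraction in lowest terms, so a rational function is defined
  at a point exactly if this denominator does not vanish there. Evaluation at \<open>a\<close> substitutes
  $q^{1/2} = a$; in particular the value at $q = 1$ is the one with $q^{1/2} = 1$.
\<close>

definition regular_at :: "ratfun \<Rightarrow> rat \<Rightarrow> bool" where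
  "regular_at r a \<longleftrightarrow> poly (snd (quot_of_fract r)) a \<noteq> 0"

definition value_at :: "ratfun \<Rightarrow> rat \<Rightarrow> rat" where
  "value_at r a = poly (fst (quot_of_fract r)) a / poly (snd (quot_of_fract r)) a"

text \<open>
  The expansion of a rational function as a Laurent series in $q^{1/2}$ (at $q^{1/2} = 0$).
  For a Laurent polynomial its coefficients are the coefficients of that Laurent polynomial.
\<close>

definition laurent_expansion :: "ratfun \<Rightarrow> rat fls" where
  "laurent_expansion r =
     fps_to_fls (fps_of_poly (fst (quot_of_fract r))) /
     fps_to_fls (fps_of_poly (snd (quot_of_fract r)))"

definition moebius_mu :: "nat \<Rightarrow> rat" where
  "moebius_mu d = (if squarefree d then (- 1) ^ card (prime_factors d) else 0)"

text \<open>The map $\Psi_d$, first on coefficients, then on power series in $x$ (for \<open>d \<ge> 1\<close>).\<close>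

definition adams_coeff :: "nat \<Rightarrow> ratfun \<Rightarrow> ratfun" where
  "adams_coeff d r =
     to_fract (pcompose (fst (quot_of_fract r)) (monom 1 d)) /
     to_fract (pcompose (snd (quot_of_fract r)) (monom 1 d))"

definition adams :: "nat \<Rightarrow> ratfun fps \<Rightarrow> ratfun fps" where
  "adams d F = Abs_fps (\<lambda>n. if d dvd n then adams_coeff d (fps_nth F (n div d)) else 0)"

text \<open>\<^term>\<open>fps_ln 1\<close> is the series of $\log(1 + x)$.\<close>

definition fps_log :: "ratfun fps \<Rightarrow> ratfun fps" where
  "fps_log F = fps_compose (fps_ln 1) (F - 1)"

text \<open>
  As $\log F$ has no constant term, $\Psi_d(\log F)$ only has terms of degree at least \<open>d\<close>.
  So in the sum over all \<open>d \<ge> 1\<close> only \<open>d \<le> n\<close> contributes to the coefficient of $x^n$.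
\<close>

definition plethystic_Log :: "ratfun fps \<Rightarrow> ratfun fps" where
  "plethystic_Log F =
     Abs_fps (\<lambda>n. \<Sum>d=1..n. of_rat (moebius_mu d / of_nat d) * fps_nth (adams d (fps_log F)) n)"

text \<open>$q^{n(n-1)/2 + n^2/2} = (q^{1/2})^{n(n-1) + n^2}$\<close>

definition Z_series :: "ratfun fps" where
  "Z_series = Abs_fps (\<lambda>n. qhalf ^ (n * (n - 1) + n ^ 2) / (\<Prod>i=1..n. 1 - q ^ i))"

definition f1 :: "nat \<Rightarrow> ratfun" where
  "f1 m = (qhalf - inverse qhalf) * fps_nth (plethystic_Log Z_series) m"

definition N1 :: "nat \<Rightarrow> int \<Rightarrow> rat" where
  "N1 m k = fls_nth (laurent_expansion (f1 m)) k"

definition nmk :: "nat \<Rightarrow> int \<Rightarrow> rat" where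
  "nmk m k = (- 1) ^ m * N1 m k"

text \<open>Meaningful only if almost all \<^term>\<open>nmk m k\<close> vanish, as a sum over an infinite set is \<open>0\<close>.\<close>

definition g :: "nat \<Rightarrow> ratfun" where
  "g m = (\<Sum>k | nmk m k \<noteq> 0. of_rat (nmk m k) * q powi k)"

end

theory Submission
  imports Defs "HOL-Analysis.Determinants"
begin

text \<open>
  Put $s = q^{1/2}$. The given series is $G(sx)$ for $G = \sum_n q^{n(n-1)} x^n / ((1-q)\cdots(1-q^n))$,
  and $G(x) - G(qx) = x\,G(q^2x)$. Hence the quotient $U(x) = G(qx)/G(x)$ satisfies
  $U(x) = 1 - x\,U(x)\,U(qx)$: up to the sign of $x$ it is the Carlitz--Riordan $q$-analogue of the
  Catalan generating function, and unlike $G$ it has coefficients in $\mathbb{Z}[q]$.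

  Write $T(F) = x F'/F$. Since $[x^n] \log F = T(F)_n / n$, the coefficient $[x^m]\,\mathrm{Log}(F)$ is
  $\frac1m \sum_{e \mid m} \mu(e)\,\Psi_e(T(F)_{m/e})$. From $T(U)_n = (q^n - 1)\,T(G)_n$, and because
  $\Psi_e$ turns $q^{m/e} - 1$ into $q^m - 1$ for every $e \mid m$, it follows that
  $m\,(q^m-1)\,[x^m]\,\mathrm{Log}(G(sx)) = s^m\,W_m$ with
  $W_m = \sum_{e \mid m} \mu(e)\,\Psi_e(T(U)_{m/e}) \in \mathbb{Z}[q]$.
  The integrality statement therefore amounts to two divisibilities of $W_m$ in $\mathbb{Z}[q]$.

  The first is $m \mid W_m$ (\<open>dvd_moebius_trace\<close>): the plethystic logarithm of every series in
  $1 + x\mathbb{Z}[q][[x]]$ has coefficients in $\mathbb{Z}[q]$, because such a series is a product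
  of powers of factors $1 - q^j x^k$, whose plethystic logarithm is $-q^j x^k$.

  The second is $1 + q + \dots + q^{m-1} \mid W_m$, that is, $W_m$ vanishes at every $m$-th root of
  unity $z \ne 1$ (\<open>int_eval_moebius_trace_qcat_root_of_unity\<close>). If $z$ has order $r$, then
  $T(U)_{rn}$ at $q = z$ equals $T(U)_n$ at $q = 1$ (\<open>log_deriv_qcat_primitive_root\<close>), so the
  summands of $W_m(z)$ depend on $e$ only through $\mathrm{lcm}(e, r)$ and cancel in pairs $e$, $pe$
  for a prime $p \mid r$.

  Together, $W_m = m\,(1 + q + \dots + q^{m-1})\,D$ with $D \in \mathbb{Z}[q]$, and so
  $f_m^1 = s^{m-1} D(q)$ (\<open>f1_eq_integer_polynomial\<close>) is a polynomial in $q^{1/2}$ with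
  integer coefficients. The claims about its coefficients and its value at $1$ follow.
\<close>

\<comment> \<open>In this theory the infix \<open>$\<close> is reserved for entries of vectors and matrices.\<close>
no_notation fps_nth (infixl "$" 75)

section \<open>Ring morphisms and evaluation of integer polynomials\<close>

definition ring_morphism :: "('a::comm_ring_1 \<Rightarrow> 'b::comm_ring_1) \<Rightarrow> bool" where
  "ring_morphism h \<longleftrightarrow> h 1 = 1 \<and> (\<forall>x y. h (x + y) = h x + h y) \<and> (\<forall>x y. h (x * y) = h x * h y)"

context
  fixes h :: "'a::comm_ring_1 \<Rightarrow> 'b::comm_ring_1"
  assumes h: "ring_morphism h"
begin

lemma ring_morphism_1: "h 1 = 1"
  and ring_morphism_add: "h (x + y) = h x + h y"
  and ring_morphism_mult: "h (x * y) = h x * h y"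
  using h by (simp_all add: ring_morphism_def)

lemma ring_morphism_0: "h 0 = 0"
  using ring_morphism_add[of 0 0] by simp

lemma ring_morphism_uminus: "h (- x) = - h x"
  using ring_morphism_add[of x "- x"] by (simp add: ring_morphism_0 eq_neg_iff_add_eq_0 add.commute)

lemma ring_morphism_sum: "h (sum f A) = (\<Sum>x\<in>A. h (f x))"
  by (induction A rule: infinite_finite_induct) (simp_all add: ring_morphism_0 ring_morphism_add)

lemma ring_morphism_power: "h (x ^ n) = h x ^ n"
  by (induction n) (simp_all add: ring_morphism_1 ring_morphism_mult)

lemma ring_morphism_of_nat: "h (of_nat n) = of_nat n"
  by (induction n) (simp_all add: ring_morphism_0 ring_morphism_1 ring_morphism_add)

lemma ring_morphism_of_int: "h (of_int k) = of_int k"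
  by (cases k) (simp_all add: ring_morphism_of_nat ring_morphism_uminus del: of_nat_Suc)

end

text \<open>
  The unique ring morphism from $\mathbb{Z}[X]$ that sends $X$ to $a$. Evaluation at a root of unity,
  the substitution $X \mapsto X^e$ (the case \<^term>\<open>a = monom 1 e\<close>) and the embedding of
  $\mathbb{Z}[q]$ into \<^typ>\<open>ratfun\<close> are all of this form, so that they compose by one rule.
\<close>

definition int_eval :: "'a::comm_ring_1 \<Rightarrow> int poly \<Rightarrow> 'a" where
  "int_eval a p = poly (map_poly of_int p) a"

lemma int_eval_0 [simp]: "int_eval a 0 = 0"
  by (simp add: int_eval_def)

lemma int_eval_pCons [simp]: "int_eval a (pCons c p) = of_int c + a * int_eval a p"
  by (cases "pCons c p = 0") (simp_all add: int_eval_def map_poly_pCons)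

lemma int_eval_add [simp]: "int_eval a (p + r) = int_eval a p + int_eval a r"
proof (induction p arbitrary: r)
  case (pCons c p)
  show ?case
    by (cases r) (simp add: pCons.IH distrib_left)
qed simp

lemma int_eval_smult [simp]: "int_eval a (smult c p) = of_int c * int_eval a p"
  by (induction p) (simp_all add: algebra_simps)

lemma int_eval_mult [simp]: "int_eval a (p * r) = int_eval a p * int_eval a r"
  by (induction p) (simp_all add: algebra_simps)

lemma int_eval_1 [simp]: "int_eval a 1 = 1"
  by (simp add: one_pCons)

lemma ring_morphism_int_eval: "ring_morphism (int_eval a)"
  by (simp add: ring_morphism_def)

lemmas int_eval_uminus [simp] = ring_morphism_uminus[OF ring_morphism_int_eval]
  and int_eval_sum = ring_morphism_sum[OF ring_morphism_int_eval]
  and int_eval_power [simp] = ring_morphism_power[OF ring_morphism_int_eval]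
  and int_eval_of_nat [simp] = ring_morphism_of_nat[OF ring_morphism_int_eval]
  and int_eval_of_int [simp] = ring_morphism_of_int[OF ring_morphism_int_eval]

lemma int_eval_monom [simp]: "int_eval a (monom c n) = of_int c * a ^ n"
  by (induction n) (simp_all add: monom_0 monom_Suc algebra_simps)

lemma int_eval_eq_poly: "int_eval a p = poly p a"
  by (induction p) simp_all

lemma ring_morphism_comp_int_eval:
  assumes "ring_morphism h"
  shows "h (int_eval a p) = int_eval (h a) p"
  by (induction p)
    (simp_all add: ring_morphism_0[OF assms] ring_morphism_add[OF assms] ring_morphism_mult[OF assms]
      ring_morphism_of_int[OF assms])

section \<open>Logarithmic derivatives of power series\<close>

definition fps_scale :: "'a::comm_ring_1 \<Rightarrow> 'a fps \<Rightarrow> 'a fps" where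
  "fps_scale a F = Abs_fps (\<lambda>n. a ^ n * fps_nth F n)"

lemma fps_scale_nth [simp]: "fps_nth (fps_scale a F) n = a ^ n * fps_nth F n"
  by (simp add: fps_scale_def)

lemma fps_scale_1 [simp]: "fps_scale a 1 = 1"
  by (rule fps_ext) simp

lemma fps_scale_by_1 [simp]: "fps_scale 1 F = F"
  by (rule fps_ext) simp

lemma fps_scale_X [simp]: "fps_scale a fps_X = fps_const a * fps_X"
  by (rule fps_ext) (simp add: fps_X_def)

lemma fps_scale_const [simp]: "fps_scale a (fps_const c) = fps_const c"
  by (rule fps_ext) simp

lemma fps_scale_add [simp]: "fps_scale a (F + G) = fps_scale a F + fps_scale a G"
  by (rule fps_ext) (simp add: algebra_simps)

lemma fps_scale_diff [simp]: "fps_scale a (F - G) = fps_scale a F - fps_scale a G"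
  by (rule fps_ext) (simp add: algebra_simps)

lemma fps_scale_mult [simp]: "fps_scale a (F * G) = fps_scale a F * fps_scale a G"
proof (rule fps_ext)
  fix n
  have "a ^ n * (fps_nth F i * fps_nth G (n - i))
      = (a ^ i * fps_nth F i) * (a ^ (n - i) * fps_nth G (n - i))" if "i \<in> {0..n}" for i
    using that by (simp add: algebra_simps flip: power_add)
  thus "fps_nth (fps_scale a (F * G)) n = fps_nth (fps_scale a F * fps_scale a G) n"
    unfolding fps_scale_nth fps_mult_nth sum_distrib_left by (intro sum.cong) auto
qed

lemma fps_scale_scale [simp]: "fps_scale a (fps_scale b F) = fps_scale (a * b) F"
  by (rule fps_ext) (simp add: power_mult_distrib algebra_simps)

lemma fps_scale_deriv: "fps_X * fps_deriv (fps_scale a F) = fps_scale a (fps_X * fps_deriv F)"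
proof (rule fps_ext)
  fix n
  show "fps_nth (fps_X * fps_deriv (fps_scale a F)) n = fps_nth (fps_scale a (fps_X * fps_deriv F)) n"
    by (cases n) (simp_all add: algebra_simps del: of_nat_Suc)
qed

text \<open>
  $T(F) = x F'/F$ for $F$ with constant term $1$. The ring-theoretic inverse allows coefficients
  in $\mathbb{Z}[q]$, where the notion is compatible with all evaluations of $q$.
\<close>

definition log_deriv :: "'a::comm_ring_1 fps \<Rightarrow> 'a fps" where
  "log_deriv F = fps_X * fps_deriv F * fps_left_inverse F 1"

lemma log_deriv_unique:
  assumes "fps_nth F 0 = 1"
  shows "T = log_deriv F \<longleftrightarrow> T * F = fps_X * fps_deriv F"
proof -
  have inv: "fps_left_inverse F 1 * F = 1"
    using assms by (intro fps_left_inverse) simp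
  have "T = log_deriv F" if "T * F = fps_X * fps_deriv F"
  proof -
    have "T = T * F * fps_left_inverse F 1"
      using inv by (metis mult.assoc mult.commute mult.right_neutral)
    thus ?thesis by (simp add: that log_deriv_def)
  qed
  moreover have "log_deriv F * F = fps_X * fps_deriv F"
    using inv by (simp add: log_deriv_def mult.assoc)
  ultimately show ?thesis by blast
qed

lemma log_deriv_times:
  assumes "fps_nth F 0 = 1"
  shows "log_deriv F * F = fps_X * fps_deriv F"
  using log_deriv_unique[OF assms] by blast

lemma log_deriv_eqI:
  assumes "fps_nth F 0 = 1" "T * F = fps_X * fps_deriv F"
  shows "log_deriv F = T"
  using log_deriv_unique[OF assms(1)] assms(2) by metis

lemma log_deriv_1 [simp]: "log_deriv 1 = 0"
  by (rule log_deriv_eqI) simp_all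

lemma log_deriv_mult:
  assumes "fps_nth F 0 = 1" "fps_nth G 0 = 1"
  shows "log_deriv (F * G) = log_deriv F + log_deriv G"
proof (rule log_deriv_eqI)
  have "(log_deriv F + log_deriv G) * (F * G) = (log_deriv F * F) * G + (log_deriv G * G) * F"
    by (simp add: algebra_simps)
  also have "\<dots> = fps_X * fps_deriv (F * G)"
    unfolding log_deriv_times[OF assms(1)] log_deriv_times[OF assms(2)] by (simp add: algebra_simps)
  finally show "(log_deriv F + log_deriv G) * (F * G) = fps_X * fps_deriv (F * G)" .
qed (use assms in simp)

lemma log_deriv_prod:
  assumes "\<And>i. i \<in> A \<Longrightarrow> fps_nth (F i) 0 = 1"
  shows "log_deriv (\<Prod>i\<in>A. F i) = (\<Sum>i\<in>A. log_deriv (F i)) \<and> fps_nth (\<Prod>i\<in>A. F i) 0 = 1"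
  using assms
  by (induction A rule: infinite_finite_induct) (simp_all add: log_deriv_mult)

lemma log_deriv_scale:
  assumes "fps_nth F 0 = 1"
  shows "log_deriv (fps_scale a F) = fps_scale a (log_deriv F)"
  using assms
  by (intro log_deriv_eqI) (simp_all add: fps_scale_deriv log_deriv_times flip: fps_scale_mult)

text \<open>
  The equation $T(F) F = x F'$ has a unique solution $T(F)$ and is preserved by ring morphisms.
\<close>

lemma log_deriv_nth_morphism:
  assumes h: "ring_morphism h" and F: "fps_nth F 0 = 1"
    and G: "\<And>n. fps_nth G n = h (fps_nth F n)"
  shows "fps_nth (log_deriv G) n = h (fps_nth (log_deriv F) n)"
proof -
  note hom = ring_morphism_0[OF h] ring_morphism_1[OF h] ring_morphism_sum[OF h]
    ring_morphism_mult[OF h] ring_morphism_of_nat[OF h]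
  have "log_deriv G = Abs_fps (\<lambda>n. h (fps_nth (log_deriv F) n))"
  proof (rule log_deriv_eqI)
    show "fps_nth G 0 = 1" by (simp add: G F hom)
    show "Abs_fps (\<lambda>n. h (fps_nth (log_deriv F) n)) * G = fps_X * fps_deriv G"
    proof (rule fps_ext)
      fix n
      have "fps_nth (Abs_fps (\<lambda>n. h (fps_nth (log_deriv F) n)) * G) n = h (fps_nth (log_deriv F * F) n)"
        by (simp add: fps_mult_nth G hom)
      also have "\<dots> = fps_nth (fps_X * fps_deriv G) n"
        by (cases n) (simp_all add: log_deriv_times[OF F] G hom del: of_nat_Suc)
      finally show "fps_nth (Abs_fps (\<lambda>n. h (fps_nth (log_deriv F) n)) * G) n
          = fps_nth (fps_X * fps_deriv G) n" .
    qed
  qed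
  thus ?thesis by simp
qed

lemma log_deriv_nth_eq_0:
  assumes "fps_nth F 0 = 1" "\<And>i. 0 < i \<Longrightarrow> i \<le> n \<Longrightarrow> fps_nth F i = 0"
  shows "fps_nth (log_deriv F) n = 0"
  using assms(2)
proof (induction n rule: less_induct)
  case (less n)
  have "fps_nth (log_deriv F) n = fps_nth (log_deriv F * F) n"
  proof -
    have "fps_nth (log_deriv F * F) n = (\<Sum>i=0..n. if i = n then fps_nth (log_deriv F) n else 0)"
      unfolding fps_mult_nth using less by (intro sum.cong) (auto simp: assms(1))
    thus ?thesis by simp
  qed
  also have "\<dots> = 0"
    using less.prems by (cases n) (simp_all add: log_deriv_times[OF assms(1)])
  finally show ?case .
qed

section \<open>The q-Catalan series\<close>

text \<open>
  The recursion is $U(x) = 1 - x\,U(x)\,U(ax)$ read coefficientwise. For $a = 1$ it gives the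
  Catalan numbers with alternating signs, for general $a$ their Carlitz--Riordan analogues.
\<close>

fun qcat_coeff :: "'a::comm_ring_1 \<Rightarrow> nat \<Rightarrow> 'a" where
  "qcat_coeff a 0 = 1"
| "qcat_coeff a (Suc n) = - (\<Sum>i=0..n. qcat_coeff a i * (a ^ (n - i) * qcat_coeff a (n - i)))"

definition qcat :: "'a::comm_ring_1 \<Rightarrow> 'a fps" where
  "qcat a = Abs_fps (qcat_coeff a)"

lemma qcat_nth_0 [simp]: "fps_nth (qcat a) 0 = 1"
  by (simp add: qcat_def)

lemma qcat_equation: "qcat a = 1 - fps_X * (qcat a * fps_scale a (qcat a))"
proof (rule fps_ext)
  fix n
  show "fps_nth (qcat a) n = fps_nth (1 - fps_X * (qcat a * fps_scale a (qcat a))) n"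
    by (cases n) (simp_all add: qcat_def fps_mult_nth[of "Abs_fps _"])
qed

lemma qcat_unique:
  assumes "U = 1 - fps_X * (U * fps_scale a U)"
  shows "U = qcat a"
proof -
  have "fps_nth U n = qcat_coeff a n" for n
  proof (induction n rule: less_induct)
    case (less n)
    show ?case
    proof (cases n)
      case 0
      thus ?thesis by (subst assms) simp
    next
      case (Suc k)
      have "fps_nth U n = - (\<Sum>i=0..k. fps_nth U i * (a ^ (k - i) * fps_nth U (k - i)))"
        by (subst assms) (simp add: Suc fps_mult_nth[of U])
      also have "\<dots> = qcat_coeff a n"
        using less by (simp add: Suc)
      finally show ?thesis .
    qed
  qed
  thus ?thesis by (simp add: qcat_def fps_eq_iff)
qed

text \<open>
  Allows the passage from the polynomial ring, where $a$ is the variable, to roots of unity and to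
  rational functions.
\<close>

lemma log_deriv_qcat_morphism:
  assumes h: "ring_morphism h"
  shows "h (fps_nth (log_deriv (qcat a)) n) = fps_nth (log_deriv (qcat (h a))) n"
proof -
  note hom = ring_morphism_0[OF h] ring_morphism_1[OF h] ring_morphism_sum[OF h]
    ring_morphism_mult[OF h] ring_morphism_uminus[OF h] ring_morphism_power[OF h]
  have "qcat_coeff (h a) n = h (qcat_coeff a n)" for n
    by (induction n rule: less_induct) (case_tac x, simp_all add: hom)
  thus ?thesis
    using log_deriv_nth_morphism[OF h, of "qcat a" "qcat (h a)" n] by (simp add: qcat_def)
qed

section \<open>Moebius sums\<close>

definition moebius_int :: "nat \<Rightarrow> int" where
  "moebius_int d = (if squarefree d then (- 1) ^ card (prime_factors d) else 0)"

lemma moebius_mu_eq: "moebius_mu d = of_int (moebius_int d)"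
  by (simp add: moebius_mu_def moebius_int_def)

lemma moebius_int_1 [simp]: "moebius_int (Suc 0) = 1"
  by (simp add: moebius_int_def)

lemma moebius_int_prime_times:
  assumes "prime p" "\<not> p dvd e"
  shows "moebius_int (p * e) = - moebius_int e"
proof -
  have cop: "coprime p e"
    using assms by (simp add: prime_imp_coprime)
  have e: "e \<noteq> 0" using assms(2) by (metis dvd_0_right)
  have "squarefree (p * e) \<longleftrightarrow> squarefree e"
    using assms cop by (meson squarefree_mult_coprime squarefree_multD(2) squarefree_prime)
  moreover have "prime_factors (p * e) = insert p (prime_factors e)"
    using assms(1) e by (simp add: prime_factors_product prime_prime_factors prime_gt_0_nat)
  moreover have "p \<notin> prime_factors e" using assms by auto
  ultimately show ?thesis by (simp add: moebius_int_def)
qed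

lemma moebius_int_square:
  assumes "prime p" "p ^ 2 dvd e"
  shows "moebius_int e = 0"
  using assms by (auto simp: moebius_int_def squarefree_def dest: not_prime_unit)

text \<open>
  Only squarefree $e$ contribute; they come in pairs $e$, $pe$ with $p \nmid e$, and
  $\mu(pe) = -\mu(e)$.
\<close>

lemma moebius_sum_eq_0:
  fixes f :: "nat \<Rightarrow> 'a::comm_ring_1"
  assumes "prime p" "p dvd d" "d > 0"
    and f: "\<And>e. e dvd d \<Longrightarrow> \<not> p dvd e \<Longrightarrow> f (p * e) = f e"
  shows "(\<Sum>e | e dvd d. of_int (moebius_int e) * f e) = 0"
proof -
  define A where "A = {e. e dvd d \<and> \<not> p dvd e}"
  have fin: "finite {e. e dvd d}" using assms by simp
  have p0: "p > 0" using assms(1) by (simp add: prime_gt_0_nat)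
  have sub: "A \<union> (*) p ` A \<subseteq> {e. e dvd d}"
  proof -
    have "p * e dvd d" if "e \<in> A" for e
      using that assms(1,2) by (auto simp: A_def intro!: divides_mult prime_imp_coprime)
    thus ?thesis by (auto simp: A_def)
  qed
  have "(\<Sum>e | e dvd d. of_int (moebius_int e) * f e)
      = (\<Sum>e \<in> A \<union> (*) p ` A. of_int (moebius_int e) * f e)"
  proof (rule sum.mono_neutral_right[OF fin sub], rule ballI)
    fix e assume "e \<in> {e. e dvd d} - (A \<union> (*) p ` A)"
    hence e: "e dvd d" "e \<notin> A" "e \<notin> (*) p ` A" by auto
    then obtain k where k: "e = p * k" by (auto simp: A_def)
    hence "p dvd k"
      using e by (auto simp: A_def dest: dvd_mult_right)
    hence "moebius_int e = 0"
      using k by (intro moebius_int_square[OF assms(1)]) (auto simp: power2_eq_square)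
    thus "of_int (moebius_int e) * f e = 0" by simp
  qed
  also have "\<dots> = (\<Sum>e\<in>A. of_int (moebius_int e) * f e) + (\<Sum>e\<in>(*) p ` A. of_int (moebius_int e) * f e)"
    using fin by (intro sum.union_disjoint) (auto simp: A_def)
  also have "(\<Sum>e\<in>(*) p ` A. of_int (moebius_int e) * f e)
      = (\<Sum>e\<in>A. of_int (moebius_int (p * e)) * f (p * e))"
    using p0 by (subst sum.reindex) (auto simp: inj_on_def)
  also have "\<dots> = (\<Sum>e\<in>A. - (of_int (moebius_int e) * f e))"
    by (intro sum.cong) (auto simp: A_def moebius_int_prime_times[OF assms(1)] f)
  finally show ?thesis by (simp add: sum_negf)
qed

lemma moebius_sum: "n > 0 \<Longrightarrow> (\<Sum>e | e dvd n. moebius_int e) = (if n = 1 then 1 else 0)"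
proof (cases "n = 1")
  case False
  assume "n > 0"
  from False obtain p where "prime p" "p dvd n" using prime_factor_nat by blast
  with \<open>n > 0\<close> have "(\<Sum>e | e dvd n. of_int (moebius_int e) * (1::int)) = 0"
    by (intro moebius_sum_eq_0[of p]) auto
  with False show ?thesis by simp
qed simp

section \<open>Integrality of the plethystic logarithm over the integer polynomials\<close>

text \<open>
  For $F \in 1 + x\mathbb{Z}[X][[x]]$ this is $m \cdot [x^m]\,\mathrm{Log}(F)$.
\<close>

definition moebius_trace :: "nat \<Rightarrow> int poly fps \<Rightarrow> int poly" where
  "moebius_trace m F =
     (\<Sum>e | e dvd m. of_int (moebius_int e) * int_eval (monom 1 e) (fps_nth (log_deriv F) (m div e)))"

lemma moebius_trace_mult:
  assumes "fps_nth F 0 = 1" "fps_nth G 0 = 1"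
  shows "moebius_trace m (F * G) = moebius_trace m F + moebius_trace m G"
  by (simp add: moebius_trace_def log_deriv_mult[OF assms] algebra_simps sum.distrib)

lemma log_deriv_one_minus_monomial:
  fixes c :: "'a::comm_ring_1"
  assumes "k > 0"
  shows "log_deriv (1 - fps_const c * fps_X ^ k)
    = Abs_fps (\<lambda>n. if k dvd n \<and> n > 0 then - of_nat k * c ^ (n div k) else 0)" (is "_ = ?T")
proof (rule log_deriv_eqI)
  show "fps_nth (1 - fps_const c * fps_X ^ k) 0 = 1"
    using assms by (simp add: fps_X_power_iff)
  show "?T * (1 - fps_const c * fps_X ^ k) = fps_X * fps_deriv (1 - fps_const c * fps_X ^ k)"
  proof (rule fps_ext)
    fix n
    have "?T * (1 - fps_const c * fps_X ^ k) = ?T - fps_const c * (fps_X ^ k * ?T)"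
      by (simp add: algebra_simps)
    hence "fps_nth (?T * (1 - fps_const c * fps_X ^ k)) n
      = fps_nth ?T n - c * (if n < k then 0 else fps_nth ?T (n - k))"
      by (simp only: fps_sub_nth fps_mult_left_const_nth fps_X_power_mult_nth)
    also have "\<dots> = (if n = k then - of_nat k * c else 0)"
    proof (cases "k < n \<and> k dvd n")
      case True
      then obtain j where "n = k * j" by auto
      with True assms obtain i where i: "n = k * Suc (Suc i)"
        by (cases j; cases "j - 1") auto
      hence "n - k = k * Suc i" by simp
      with i assms show ?thesis by (simp add: algebra_simps)
    next
      case False
      thus ?thesis using assms by (auto simp: dvd_minus_self dest: dvd_imp_le)
    qed
    also have "\<dots> = fps_nth (fps_X * fps_deriv (1 - fps_const c * fps_X ^ k)) n"
      using assms by (cases n) (auto simp: fps_X_power_iff simp del: of_nat_Suc)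
    finally show "fps_nth (?T * (1 - fps_const c * fps_X ^ k)) n
      = fps_nth (fps_X * fps_deriv (1 - fps_const c * fps_X ^ k)) n" .
  qed
qed

text \<open>
  The plethystic logarithm of $1 - X^j x^k$ is $-X^j x^k$: for $k \mid m$, every $e$ dividing $m/k$
  contributes $-k\mu(e) X^{jm/k}$, and the sum of these $\mu(e)$ is $0$ unless $m = k$.
\<close>

lemma dvd_moebius_trace_one_minus_monomial:
  assumes "m > 0" "k > 0"
  shows "of_nat m dvd moebius_trace m (1 - fps_const (monom 1 j) * fps_X ^ k)"
proof (cases "k dvd m")
  case False
  have "moebius_trace m (1 - fps_const (monom 1 j) * fps_X ^ k) = 0"
    unfolding moebius_trace_def log_deriv_one_minus_monomial[OF assms(2)]
  proof (intro sum.neutral ballI)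
    fix e assume "e \<in> {e. e dvd m}"
    hence "m div e dvd m" by auto
    hence "\<not> k dvd m div e" using False dvd_trans by blast
    thus "of_int (moebius_int e) * int_eval (monom 1 e) (fps_nth (Abs_fps
      (\<lambda>n. if k dvd n \<and> 0 < n then - of_nat k * monom 1 j ^ (n div k) else 0)) (m div e)) = 0"
      by simp
  qed
  thus ?thesis by simp
next
  case True
  then obtain n where n: "m = k * n" by auto
  with assms have n0: "n > 0" by auto
  have "moebius_trace m (1 - fps_const (monom 1 j) * fps_X ^ k)
    = (\<Sum>e | e dvd m. if e dvd n then of_int (moebius_int e) * (- of_nat k * monom 1 (j * n)) else 0)"
    unfolding moebius_trace_def log_deriv_one_minus_monomial[OF assms(2)]
  proof (intro sum.cong refl)
    fix e assume "e \<in> {e. e dvd m}"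
    hence e: "e dvd m" and e0: "e > 0" using assms by (auto intro: Nat.gr0I)
    have iff: "k dvd m div e \<longleftrightarrow> e dvd n"
      using e e0 assms n by (metis dvd_div_iff_mult dvd_times_left_cancel_iff mult.commute not_gr0)
    show "of_int (moebius_int e) * int_eval (monom 1 e) (fps_nth (Abs_fps
        (\<lambda>n. if k dvd n \<and> 0 < n then - of_nat k * monom 1 j ^ (n div k) else 0)) (m div e))
      = (if e dvd n then of_int (moebius_int e) * (- of_nat k * monom 1 (j * n)) else 0)"
    proof (cases "e dvd n")
      case True
      then obtain i where i: "n = e * i" by auto
      have "m div e = k * i" using n i e0 by simp
      moreover have "i > 0" using n0 i by auto
      ultimately show ?thesis
        using assms True i by (simp add: monom_power mult_ac)
    qed (simp add: iff)
  qed
  also have "\<dots> = (\<Sum>e | e dvd n. of_int (moebius_int e) * (- of_nat k * monom 1 (j * n)))"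
    unfolding sum.inter_filter[symmetric, OF finite_divisors_nat[OF assms(1)]]
    by (intro sum.cong) (auto simp: n)
  also have "\<dots> = of_int (\<Sum>e | e dvd n. moebius_int e) * (- of_nat k * monom 1 (j * n))"
    by (simp only: of_int_sum sum_distrib_right)
  also have "of_nat m dvd \<dots>"
    by (simp add: moebius_sum[OF n0] n)
  finally show ?thesis .
qed

lemma fps_mult_nth_leading:
  fixes V W :: "'a::comm_ring_1 fps"
  assumes "fps_nth V 0 = 1" "fps_nth W 0 = 1" "n > 0"
    and "\<And>i. 0 < i \<Longrightarrow> i < n \<Longrightarrow> fps_nth V i = 0"
  shows "fps_nth (V * W) n = fps_nth V n + fps_nth W n"
proof -
  have "fps_nth (V * W) n = (\<Sum>i\<in>{0,n}. fps_nth V i * fps_nth W (n - i))"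
    unfolding fps_mult_nth using assms by (intro sum.mono_neutral_right) auto
  thus ?thesis using assms by simp
qed

text \<open>
  The possible leading coefficients $c$ form an additive group, as one sees from products and
  inverses of series. The factors $1 - X^j x^k$ show that this group contains every monomial $X^j$,
  hence all of $\mathbb{Z}[X]$.
\<close>

lemma exists_dvd_moebius_trace:
  fixes c :: "int poly"
  assumes "m > 0" "k > 0"
  shows "\<exists>V. fps_nth V 0 = 1 \<and> (\<forall>i. 0 < i \<longrightarrow> i < k \<longrightarrow> fps_nth V i = 0) \<and> fps_nth V k = c
    \<and> of_nat m dvd moebius_trace m V"
proof -
  define good where "good V \<longleftrightarrow> fps_nth V 0 = 1 \<and> (\<forall>i. 0 < i \<longrightarrow> i < k \<longrightarrow> fps_nth V i = 0)
    \<and> of_nat m dvd moebius_trace m V" for V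
  have mult: "good (V * W)" "fps_nth (V * W) k = fps_nth V k + fps_nth W k"
    if V: "good V" and W: "good W" for V W
  proof -
    have "fps_nth (V * W) i = fps_nth V i + fps_nth W i" if "0 < i" "i \<le> k" for i
      using V W that by (intro fps_mult_nth_leading) (auto simp: good_def)
    with assms V W show "good (V * W)" "fps_nth (V * W) k = fps_nth V k + fps_nth W k"
      by (auto simp: good_def moebius_trace_mult)
  qed
  have one: "good 1"
    by (simp add: good_def moebius_trace_def)
  have inv: "\<exists>W. good W \<and> fps_nth W k = - fps_nth V k" if V: "good V" for V
  proof -
    define W where "W = fps_left_inverse V 1"
    have W0: "fps_nth W 0 = 1" by (simp add: W_def)
    have WV: "V * W = 1"
      using V fps_left_inverse[of 1 V] by (simp add: W_def good_def mult.commute)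
    have V0: "fps_nth V 0 = 1" using V by (simp add: good_def)
    have sum0: "fps_nth V i + fps_nth W i = 0" if "0 < i" "i \<le> k" for i
    proof -
      have "fps_nth (V * W) i = fps_nth V i + fps_nth W i"
        using V that W0 by (intro fps_mult_nth_leading) (auto simp: good_def)
      thus ?thesis using that by (simp add: WV)
    qed
    have "moebius_trace m V + moebius_trace m W = 0"
      using moebius_trace_mult[OF V0 W0] by (simp add: WV moebius_trace_def)
    hence "moebius_trace m W = - moebius_trace m V"
      by (simp add: add_eq_0_iff)
    moreover have "fps_nth W i = 0" if "0 < i" "i < k" for i
      using sum0[of i] V that by (simp add: good_def)
    ultimately have "good W"
      using V W0 by (auto simp: good_def)
    moreover have "fps_nth W k = - fps_nth V k"
      using sum0[of k] assms by (simp add: add_eq_0_iff)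
    ultimately show ?thesis by blast
  qed
  define P where "P c \<longleftrightarrow> (\<exists>V. good V \<and> fps_nth V k = c)" for c
  have P0: "P 0" using one assms by (auto simp: P_def intro!: exI[of _ 1])
  have Pminus: "P (- a)" if "P a" for a
    using inv that by (auto simp: P_def)
  have Padd: "P (a + b)" if "P a" "P b" for a b
    using mult that unfolding P_def by metis
  have Pmonom1: "P (monom 1 j)" for j
  proof -
    have "good (1 - fps_const (monom 1 j) * fps_X ^ k)"
      using assms dvd_moebius_trace_one_minus_monomial[of m k j]
      by (auto simp: good_def fps_X_power_iff)
    hence "P (- monom 1 j)"
      unfolding P_def using assms
      by (intro exI[of _ "1 - fps_const (monom 1 j) * fps_X ^ k"]) (simp add: fps_X_power_iff)
    from Pminus[OF this] show ?thesis by simp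
  qed
  have Pnat: "P (monom (of_nat n) j)" for n j
    by (induction n) (use P0 Padd[OF Pmonom1] in \<open>simp_all add: add_monom[symmetric]\<close>)
  have Pmonom: "P (monom a j)" for a j
    by (cases a) (use Pnat Pminus[OF Pnat] in \<open>simp_all add: minus_monom del: of_nat_Suc\<close>)
  have "P (sum f A)" if "\<And>i. P (f i)" for f :: "nat \<Rightarrow> int poly" and A
    by (induction A rule: infinite_finite_induct) (simp_all add: P0 Padd that)
  from this[of "\<lambda>i. monom (coeff c i) i" "{..degree c}"] have "P c"
    by (simp add: Pmonom poly_as_sum_of_monoms)
  thus ?thesis by (auto simp: P_def good_def)
qed

text \<open>
  A series that is $1$ up to terms of degree greater than $m$ has trace $0$. Any other series comes
  one step closer to this case, with its trace unchanged modulo $m$, by multiplication with a series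
  that cancels its first nonconstant coefficient.
\<close>

theorem dvd_moebius_trace:
  assumes "m > 0" "fps_nth F 0 = 1"
  shows "of_nat m dvd moebius_trace m F"
proof -
  have "of_nat m dvd moebius_trace m F"
    if "k > 0" "fps_nth F 0 = 1" "\<And>i. 0 < i \<Longrightarrow> i < k \<Longrightarrow> fps_nth F i = 0" for k
    using that
  proof (induction "Suc m - k" arbitrary: k F)
    case 0
    have "fps_nth (log_deriv F) (m div e) = 0" if "e dvd m" for e
    proof (rule log_deriv_nth_eq_0)
      have le: "m div e \<le> m" by (rule div_le_dividend)
      show "fps_nth F i = 0" if "0 < i" "i \<le> m div e" for i
        using that le 0 by (metis diff_is_0_eq le_trans less_eq_Suc_le not_less_eq_eq)
    qed fact
    hence "moebius_trace m F = 0"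
      by (auto simp: moebius_trace_def intro!: sum.neutral)
    thus ?case by simp
  next
    case (Suc d)
    obtain V where V: "fps_nth V 0 = 1" "\<And>i. 0 < i \<Longrightarrow> i < k \<Longrightarrow> fps_nth V i = 0"
      "fps_nth V k = - fps_nth F k" "of_nat m dvd moebius_trace m V"
      using exists_dvd_moebius_trace[OF assms(1) \<open>k > 0\<close>, of "- fps_nth F k"] by auto
    have "fps_nth (F * V) i = 0" if "0 < i" "i < Suc k" for i
    proof -
      have "fps_nth (F * V) i = fps_nth F i + fps_nth V i"
        using that Suc.prems V by (intro fps_mult_nth_leading) auto
      thus ?thesis using that Suc.prems V by (cases "i = k") auto
    qed
    with Suc.prems V have "of_nat m dvd moebius_trace m (F * V)"
      by (intro Suc.hyps(1)[of "Suc k"]) (use Suc.hyps in auto)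
    hence "of_nat m dvd moebius_trace m F + moebius_trace m V"
      using V(1) Suc.prems by (simp add: moebius_trace_mult)
    thus ?case using V(4) by (simp add: dvd_add_left_iff)
  qed
  from this[of 1] show ?thesis using assms by simp
qed

section \<open>Roots of unity\<close>

definition primitive_root_of_unity :: "nat \<Rightarrow> 'a::comm_ring_1 \<Rightarrow> bool" where
  "primitive_root_of_unity r z \<longleftrightarrow> r > 0 \<and> (\<forall>n. z ^ n = 1 \<longleftrightarrow> r dvd n)"

lemma exists_primitive_root_of_unity:
  fixes z :: "'a::field"
  assumes "z ^ m = 1" "m > 0"
  shows "\<exists>r. primitive_root_of_unity r z"
proof -
  define r where "r = (LEAST n. n > 0 \<and> z ^ n = 1)"
  have r: "r > 0" "z ^ r = 1"
    using LeastI[of "\<lambda>n. n > 0 \<and> z ^ n = 1" m] assms by (auto simp: r_def)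
  have least: "n = 0" if "z ^ n = 1" "n < r" for n
    using not_less_Least[of n "\<lambda>n. n > 0 \<and> z ^ n = 1"] that by (auto simp: r_def)
  have "z ^ n = 1 \<longleftrightarrow> r dvd n" for n
  proof -
    have "z ^ n = z ^ (r * (n div r) + n mod r)" by simp
    also have "\<dots> = z ^ (n mod r)" by (simp only: power_add power_mult r power_one mult_1_left)
    finally have "z ^ n = z ^ (n mod r)" .
    thus ?thesis using least[of "n mod r"] r by (auto simp: mod_eq_0_iff_dvd)
  qed
  with r show ?thesis by (auto simp: primitive_root_of_unity_def)
qed

lemma primitive_root_of_unity_power:
  assumes "primitive_root_of_unity r z" "e > 0"
  shows "primitive_root_of_unity (r div gcd e r) (z ^ e)"
proof -
  have r: "r > 0" using assms by (simp add: primitive_root_of_unity_def)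
  have "r dvd e * n \<longleftrightarrow> r div gcd e r dvd n" for n
  proof -
    define g where "g = gcd e r"
    have g: "g > 0" using r by (simp add: g_def)
    have e: "e = g * (e div g)" and r': "r = g * (r div g)" by (simp_all add: g_def)
    have cop: "coprime (r div g) (e div g)"
      using r by (simp add: g_def coprime_commute div_gcd_coprime)
    have "r dvd e * n \<longleftrightarrow> g * (r div g) dvd g * ((e div g) * n)"
      using e r' by (metis mult.assoc)
    also have "\<dots> \<longleftrightarrow> r div g dvd (e div g) * n" using g by simp
    also have "\<dots> \<longleftrightarrow> r div g dvd n" using cop by (simp add: coprime_dvd_mult_right_iff)
    finally show ?thesis by (simp add: g_def)
  qed
  moreover have "r div gcd e r > 0"
    using r by (simp add: div_greater_zero_iff)
  ultimately show ?thesis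
    using assms by (simp add: primitive_root_of_unity_def flip: power_mult)
qed

text \<open>
  The product is $(-1)^r z^{r(r-1)/2}$. For even $r$ this is evaluated by $z^{r/2} = -1$, and for
  odd $r$ the exponent is a multiple of $r$.
\<close>

lemma prod_minus_powers_primitive_root:
  fixes z :: "'a::field"
  assumes "primitive_root_of_unity r z"
  shows "(\<Prod>i<r. - (z ^ i)) = -1"
proof -
  have r: "r > 0" and z: "z ^ n = 1 \<longleftrightarrow> r dvd n" for n
    using assms by (auto simp: primitive_root_of_unity_def)
  have "(\<Prod>i<r. - (z ^ i)) = (-1) ^ r * z ^ (\<Sum>i<r. i)"
    by (simp add: prod_uminus power_sum)
  also have "(\<Sum>i<r. i) = r * (r - 1) div 2"
    using Sum_Icc_nat[of 0 "r - 1"] r by (simp add: atLeast0AtMost lessThan_Suc_atMost[symmetric] mult.commute)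
  also have "(-1) ^ r * z ^ (r * (r - 1) div 2) = -1"
  proof (cases "even r")
    case True
    then obtain k where k: "r = 2 * k" by auto
    with r have k0: "k > 0" by simp
    have "(z ^ k) ^ 2 = 1" using z[of r] by (simp add: k mult.commute flip: power_mult)
    moreover have "z ^ k \<noteq> 1" using z[of k] k k0 by (auto dest: dvd_imp_le)
    ultimately have zk: "z ^ k = -1" by (simp add: power2_eq_1_iff)
    have "r * (r - 1) div 2 = k * (2 * k - 1)" by (simp add: k)
    hence "z ^ (r * (r - 1) div 2) = (-1) ^ (2 * k - 1)" by (simp add: power_mult zk)
    with k0 show ?thesis by (simp add: k)
  next
    case False
    then obtain k where k: "r = 2 * k + 1" by (auto elim: oddE)
    have "r * (r - 1) div 2 = r * k" by (simp add: k)
    hence "z ^ (r * (r - 1) div 2) = 1" using z[of "r * k"] by simp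
    thus ?thesis using False by simp
  qed
  finally show ?thesis .
qed

section \<open>The q-Catalan series at a root of unity\<close>

text \<open>
  If $v = 1 + y v w$, this matrix maps the vector $(1, v)$ to the multiple $y v$ of $(1, w)$. With
  $y = -z^i x$, $v = U(z^i x)$ and $w = U(z^{i+1} x)$ this is the functional equation of the
  series at $q = z$.
\<close>

definition transfer_matrix :: "'a::comm_ring_1 \<Rightarrow> 'a ^ 2 ^ 2" where
  "transfer_matrix y = (\<chi> i j. if i = 1 then (if j = 1 then 0 else y) else (if j = 1 then -1 else 1))"

fun ordered_prod :: "(nat \<Rightarrow> 'a::comm_ring_1 ^ 'n ^ 'n) \<Rightarrow> nat \<Rightarrow> 'a ^ 'n ^ 'n" where
  "ordered_prod N 0 = mat 1"
| "ordered_prod N (Suc k) = N k ** ordered_prod N k"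

lemma ordered_prod_Suc_shift:
  "ordered_prod N (Suc k) = ordered_prod (\<lambda>i. N (Suc i)) k ** N 0"
proof (induction k)
  case (Suc k)
  have "ordered_prod N (Suc (Suc k)) = N (Suc k) ** (ordered_prod (\<lambda>i. N (Suc i)) k ** N 0)"
    by (subst Suc.IH[symmetric]) simp
  thus ?case by (simp add: matrix_mul_assoc)
qed simp

text \<open>
  Both products consist of the same $k$ factors, read along a cycle from different starting points.
\<close>

lemma trace_ordered_prod_rotate:
  assumes "N k = N 0" "k > 0"
  shows "trace (ordered_prod (\<lambda>i. N (Suc i)) k) = trace (ordered_prod N k)"
proof -
  obtain l where l: "k = Suc l" using assms by (cases k) auto
  have "ordered_prod (\<lambda>i. N (Suc i)) k = N 0 ** ordered_prod (\<lambda>i. N (Suc i)) l"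
    by (simp only: l ordered_prod.simps(2) assms(1)[unfolded l])
  moreover have "ordered_prod N k = ordered_prod (\<lambda>i. N (Suc i)) l ** N 0"
    by (simp only: l ordered_prod_Suc_shift)
  ultimately show ?thesis by (metis trace_mul_sym)
qed

lemma det_ordered_prod: "det (ordered_prod N k) = (\<Prod>i<k. det (N i))"
  by (induction k) (simp_all add: det_mul)

lemma det_transfer_matrix: "det (transfer_matrix y) = y"
  by (simp add: det_2 transfer_matrix_def)

lemma transfer_matrix_mult_nth:
  "(transfer_matrix y ** M) $ 1 $ j = y * M $ 2 $ j"
  "(transfer_matrix y ** M) $ 2 $ j = M $ 2 $ j - M $ 1 $ j"
  by (simp_all add: matrix_matrix_mult_def transfer_matrix_def sum_2)

lemma ordered_prod_eigenvector:
  fixes v y :: "nat \<Rightarrow> 'a::comm_ring_1"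
  assumes "\<And>i. v i = 1 + y i * v i * v (Suc i)"
  defines "M \<equiv> ordered_prod (\<lambda>i. transfer_matrix (y i))"
  shows "M k $ 1 $ 1 + M k $ 1 $ 2 * v 0 = (\<Prod>i<k. y i * v i)
       \<and> M k $ 2 $ 1 + M k $ 2 $ 2 * v 0 = (\<Prod>i<k. y i * v i) * v k"
proof (induction k)
  case 0
  show ?case by (simp add: M_def mat_def)
next
  case (Suc k)
  let ?P = "\<Prod>i<k. y i * v i"
  have M: "M (Suc k) = transfer_matrix (y k) ** M k" by (simp add: M_def)
  have "M (Suc k) $ 1 $ 1 + M (Suc k) $ 1 $ 2 * v 0 = y k * (M k $ 2 $ 1 + M k $ 2 $ 2 * v 0)"
    by (simp add: M transfer_matrix_mult_nth algebra_simps)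
  moreover have "M (Suc k) $ 2 $ 1 + M (Suc k) $ 2 $ 2 * v 0
      = (M k $ 2 $ 1 + M k $ 2 $ 2 * v 0) - (M k $ 1 $ 1 + M k $ 1 $ 2 * v 0)"
    by (simp add: M transfer_matrix_mult_nth algebra_simps)
  moreover have "?P * v k - ?P = ?P * (y k * v k) * v (Suc k)"
    by (subst (1) assms(1)) (simp add: algebra_simps)
  ultimately show ?case using Suc.IH by (simp add: mult_ac)
qed

text \<open>
  The characteristic equation for an eigenvector of the form $(1, v)$. It holds over any
  commutative ring, since the coordinate $1$ makes the elimination division-free.
\<close>

lemma eigenvalue_quadratic:
  fixes A :: "'a::comm_ring_1 ^ 2 ^ 2"
  assumes "A $ 1 $ 1 + A $ 1 $ 2 * v = l" "A $ 2 $ 1 + A $ 2 $ 2 * v = l * v"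
  shows "l ^ 2 - trace A * l + det A = 0"
proof -
  have "(l - A $ 1 $ 1) * (l - A $ 2 $ 2) = A $ 1 $ 2 * (v * l - A $ 2 $ 2 * v)"
    using assms(1) by (simp add: algebra_simps flip: assms(1))
  also have "v * l - A $ 2 $ 2 * v = A $ 2 $ 1"
    using assms(2) by (simp add: algebra_simps)
  finally show ?thesis
    by (simp add: trace_def sum_2 det_2 power2_eq_square algebra_simps)
qed

text \<open>
  For a root of unity $z$ of order $r$, the vector $(1, U(x))$ returns to a multiple of itself after
  $r$ steps, so it is an eigenvector of the cyclic product \<open>M r\<close>. Its eigenvalue is the
  product of $-z^i x\,U(z^i x)$ over the cycle.
\<close>

context
  fixes z :: "'a::field_char_0" and r :: nat and y :: "nat \<Rightarrow> 'a fps" and M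
  assumes z: "primitive_root_of_unity r z"
  defines "y \<equiv> \<lambda>i. fps_const (- (z ^ i)) * fps_X"
  defines "M \<equiv> ordered_prod (\<lambda>i. transfer_matrix (y i))"
begin

lemma linear_entry_times_nth: "fps_nth (y i * f) n = (if n = 0 then 0 else - (z ^ i) * fps_nth f (n - 1))"
  by (cases n) (simp_all add: y_def mult.assoc)

lemma linear_entry_nth_0: "fps_nth (y i) 0 = 0"
  by (simp add: y_def)

text \<open>
  Bounds for the degrees in $x$, strong enough that the trace of \<open>M k\<close> has degree less
  than $k$, together with the constant terms.
\<close>

lemma cyclic_prod_degree:
  assumes "k > 0"
  shows "(\<forall>n\<ge>k. fps_nth (M k $ 1 $ 1) n = 0 \<and> fps_nth (M k $ 2 $ 1) n = 0 \<and> fps_nth (M k $ 2 $ 2) n = 0)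
    \<and> (\<forall>n>k. fps_nth (M k $ 1 $ 2) n = 0)
    \<and> fps_nth (M k $ 1 $ 1) 0 = 0 \<and> fps_nth (M k $ 1 $ 2) 0 = 0 \<and> fps_nth (M k $ 2 $ 2) 0 = 1"
  using assms
proof (induction k rule: nat_induct_non_zero)
  case 1
  show ?case
    by (auto simp: M_def matrix_mul_rid transfer_matrix_def y_def fps_X_def)
next
  case (Suc k)
  have M: "M (Suc k) = transfer_matrix (y k) ** M k" by (simp add: M_def)
  show ?case
    using Suc by (auto simp: M transfer_matrix_mult_nth linear_entry_times_nth linear_entry_nth_0)
qed

lemma scale_cyclic_prod:
  "fps_scale z (M k $ i $ j) = ordered_prod (\<lambda>i. transfer_matrix (y (Suc i))) k $ i $ j"
proof (induction k arbitrary: i j)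
  case 0
  show ?case by (auto simp: M_def mat_def fps_eq_iff)
next
  case (Suc k)
  have M: "M (Suc k) = transfer_matrix (y k) ** M k" by (simp add: M_def)
  have y: "fps_scale z (y k) = y (Suc k)"
    by (simp add: y_def mult_ac flip: fps_const_mult)
  have "i = 1 \<or> i = 2" using exhaust_2 by blast
  thus ?case
    by (auto simp: M transfer_matrix_mult_nth y Suc.IH)
qed

text \<open>
  Replacing $x$ by $zx$ rotates the cyclic product and so preserves its trace. Hence only powers
  $x^n$ with $r \mid n$ occur in the trace, and as its degree is less than $r$, only the constant
  term remains.
\<close>

lemma trace_cyclic_prod: "trace (M r) = 1"
proof -
  have r: "r > 0" and z': "z ^ n = 1 \<longleftrightarrow> r dvd n" for n
    using z by (auto simp: primitive_root_of_unity_def)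
  have tr: "trace (A :: 'a fps ^ 2 ^ 2) = A $ 1 $ 1 + A $ 2 $ 2" for A
    by (simp add: trace_def sum_2)
  have "y r = y 0" using z' by (simp add: y_def)
  hence "trace (ordered_prod (\<lambda>i. transfer_matrix (y (Suc i))) r) = trace (M r)"
    unfolding M_def by (intro trace_ordered_prod_rotate[of "\<lambda>i. transfer_matrix (y i)"]) (use r in auto)
  hence inv: "fps_scale z (trace (M r)) = trace (M r)"
    by (simp add: tr scale_cyclic_prod)
  have "fps_nth (trace (M r)) n = fps_nth 1 n" for n
  proof -
    consider "n = 0" | "n \<ge> r" | "0 < n" "n < r" by linarith
    thus ?thesis
    proof cases
      case 3
      hence "z ^ n \<noteq> 1" using z' by (auto dest: dvd_imp_le)
      moreover have "z ^ n * fps_nth (trace (M r)) n = fps_nth (trace (M r)) n"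
        using arg_cong[OF inv, of "\<lambda>f. fps_nth f n"] by simp
      ultimately show ?thesis using 3 by simp
    qed (use cyclic_prod_degree[OF r] r in \<open>auto simp: tr\<close>)
  qed
  thus ?thesis by (simp add: fps_eq_iff)
qed

text \<open>
  Let $R$ be the product on the left. The eigenvalue of \<open>M r\<close> is $-x^r R$, its determinant
  is $-x^r$ and its trace is $1$, so the characteristic equation becomes $R = 1 - x^r R^2$. This is
  the equation of the Catalan series at $x^r$, and it has only one solution.
\<close>

lemma qcat_orbit_prod:
  "(\<Prod>i<r. fps_scale (z ^ i) (qcat z)) = fps_compose (qcat 1) (fps_X ^ r)"
proof -
  have r: "r > 0" and z': "z ^ n = 1 \<longleftrightarrow> r dvd n" for n
    using z by (auto simp: primitive_root_of_unity_def)
  define v where "v i = fps_scale (z ^ i) (qcat z)" for i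
  define R where "R = (\<Prod>i<r. v i)"
  define S where "S = fps_compose (qcat (1::'a)) (fps_X ^ r)"
  have v: "v i = 1 + y i * v i * v (Suc i)" for i
  proof -
    have y: "y i = - (fps_const (z ^ i) * fps_X)"
      by (simp add: y_def flip: fps_const_neg)
    have "v i = fps_scale (z ^ i) (1 - fps_X * (qcat z * fps_scale z (qcat z)))"
      unfolding v_def using qcat_equation[of z] by (rule arg_cong)
    also have "\<dots> = 1 + y i * v i * v (Suc i)"
      unfolding y v_def by (simp add: mult_ac)
    finally show ?thesis .
  qed
  have vr: "v r = v 0" using z'[of r] by (simp add: v_def)
  have prod_y: "(\<Prod>i<r. y i) = - (fps_X ^ r)"
  proof -
    have "(\<Prod>i<k. y i) = fps_const (\<Prod>i<k. - (z ^ i)) * fps_X ^ k" for k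
    proof (induction k)
      case (Suc k)
      have "(\<Prod>i<Suc k. y i)
          = fps_const (\<Prod>i<k. - (z ^ i)) * fps_X ^ k * (fps_const (- (z ^ k)) * fps_X)"
        by (simp only: prod.lessThan_Suc Suc.IH) (simp only: y_def)
      also have "\<dots> = fps_const (\<Prod>i<k. - (z ^ i)) * fps_const (- (z ^ k)) * fps_X ^ Suc k"
        by (simp only: mult_ac power_Suc)
      finally show ?case
        by (simp only: fps_const_mult prod.lessThan_Suc)
    qed simp
    hence "(\<Prod>i<r. y i) = fps_const (\<Prod>i<r. - (z ^ i)) * fps_X ^ r" .
    also have "\<dots> = - (fps_X ^ r)"
      unfolding prod_minus_powers_primitive_root[OF z] by (rule fps_ext) simp
    finally show ?thesis .
  qed
  have det: "det (M r) = - (fps_X ^ r)"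
    by (simp only: M_def det_ordered_prod det_transfer_matrix prod_y)
  have eigenvalue: "(\<Prod>i<r. y i * v i) = - (fps_X ^ r) * R"
    by (simp only: prod.distrib prod_y R_def)
  have "(- (fps_X ^ r) * R) ^ 2 - trace (M r) * (- (fps_X ^ r) * R) + det (M r) = 0"
    using ordered_prod_eigenvector[of v y r, OF v] unfolding vr eigenvalue
    by (intro eigenvalue_quadratic[of _ "v 0"]) (simp_all only: M_def)
  moreover have "x * (R - (1 - x * R ^ 2)) = (- x * R) ^ 2 - 1 * (- x * R) + - x" for x
    by (simp add: algebra_simps power2_eq_square)
  ultimately have "fps_X ^ r * (R - (1 - fps_X ^ r * R ^ 2)) = 0"
    by (simp only: trace_cyclic_prod det)
  moreover have "fps_X ^ r \<noteq> (0 :: 'a fps)" by simp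
  ultimately have "R - (1 - fps_X ^ r * R ^ 2) = 0" using mult_eq_0_iff by blast
  hence R: "R = 1 - fps_X ^ r * R ^ 2" by (rule eq_iff_diff_eq_0[THEN iffD2])
  have S: "S = 1 - fps_X ^ r * S ^ 2"
  proof -
    have "S = fps_compose (1 - fps_X * (qcat 1 * qcat 1)) (fps_X ^ r)"
      unfolding S_def using qcat_equation[of "1::'a"]
      by (intro arg_cong[of _ _ "\<lambda>f. fps_compose f (fps_X ^ r)"]) (simp only: fps_scale_by_1)
    also have "\<dots> = 1 - fps_X ^ r * S ^ 2"
      using r by (simp add: fps_compose_sub_distrib fps_compose_mult_distrib S_def power2_eq_square)
    finally show ?thesis .
  qed
  \<comment> \<open>Two solutions are equal, as $(R - S)(1 + x^r(R + S)) = 0$ and the second factor has constant term $1$.\<close>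
  have "R - S = (1 - fps_X ^ r * R ^ 2) - (1 - fps_X ^ r * S ^ 2)"
    using R S by (rule arg_cong2)
  moreover have "(R - S) * (1 + x * (R + S)) = (R - S) - ((1 - x * R ^ 2) - (1 - x * S ^ 2))" for x
    by (simp add: algebra_simps power2_eq_square)
  ultimately have "(R - S) * (1 + fps_X ^ r * (R + S)) = 0"
    by (simp only: diff_self)
  moreover have "fps_nth (1 + fps_X ^ r * (R + S)) 0 = 1"
    using r by simp
  hence "1 + fps_X ^ r * (R + S) \<noteq> 0" by (metis fps_zero_nth zero_neq_one)
  ultimately have "R = S" by (metis mult_eq_0_iff right_minus_eq)
  thus ?thesis by (simp add: R_def S_def v_def)
qed

text \<open>
  Compares the coefficients of $x^{rn}$ in the logarithmic derivatives of both sides of the previous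
  identity; each side contributes a factor $r$.
\<close>

lemma log_deriv_qcat_primitive_root:
  "fps_nth (log_deriv (qcat z)) (r * n) = fps_nth (log_deriv (qcat 1)) n"
proof -
  have r: "r > 0" and z': "z ^ n = 1 \<longleftrightarrow> r dvd n" for n
    using z by (auto simp: primitive_root_of_unity_def)
  have "log_deriv (\<Prod>i<r. fps_scale (z ^ i) (qcat z)) = (\<Sum>i<r. fps_scale (z ^ i) (log_deriv (qcat z)))"
    using log_deriv_prod[of "{..<r}" "\<lambda>i. fps_scale (z ^ i) (qcat z)"]
    by (simp add: log_deriv_scale)
  hence "fps_nth (log_deriv (\<Prod>i<r. fps_scale (z ^ i) (qcat z))) (r * n)
      = (\<Sum>i<r. (z ^ i) ^ (r * n) * fps_nth (log_deriv (qcat z)) (r * n))"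
    by (simp add: fps_sum_nth)
  also have "\<dots> = (\<Sum>i<r. fps_nth (log_deriv (qcat z)) (r * n))"
  proof (rule sum.cong)
    fix i
    have "(z ^ i) ^ (r * n) = 1" using z'[of "i * (r * n)"] by (simp flip: power_mult)
    thus "(z ^ i) ^ (r * n) * fps_nth (log_deriv (qcat z)) (r * n) = fps_nth (log_deriv (qcat z)) (r * n)"
      by simp
  qed simp
  finally have 1: "fps_nth (log_deriv (\<Prod>i<r. fps_scale (z ^ i) (qcat z))) (r * n)
    = of_nat r * fps_nth (log_deriv (qcat z)) (r * n)" by simp
  have "log_deriv (fps_compose (qcat 1) (fps_X ^ r))
    = of_nat r * fps_compose (log_deriv (qcat (1::'a))) (fps_X ^ r)"
  proof (rule log_deriv_eqI)
    let ?U = "qcat (1::'a)"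
    have r0: "fps_nth (fps_X ^ r :: 'a fps) 0 = 0" using r by simp
    have "fps_compose (log_deriv ?U) (fps_X ^ r) * fps_compose ?U (fps_X ^ r)
      = fps_compose (fps_X * fps_deriv ?U) (fps_X ^ r)"
      by (simp add: log_deriv_times flip: fps_compose_mult_distrib[OF r0])
    also have "\<dots> = fps_X ^ r * fps_compose (fps_deriv ?U) (fps_X ^ r)"
      using r by (simp add: fps_compose_mult_distrib[OF r0])
    finally have "of_nat r * fps_compose (log_deriv ?U) (fps_X ^ r) * fps_compose ?U (fps_X ^ r)
      = of_nat r * fps_X ^ r * fps_compose (fps_deriv ?U) (fps_X ^ r)"
      by (simp add: mult.assoc)
    also have "of_nat r * fps_X ^ r = fps_X * fps_deriv (fps_X ^ r :: 'a fps)"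
    proof -
      have "fps_deriv (fps_X ^ r :: 'a fps) = of_nat r * fps_X ^ (r - 1)"
        by (simp only: fps_deriv_power' fps_deriv_fps_X mult_1_right)
      moreover have "(fps_X :: 'a fps) ^ r = fps_X * fps_X ^ (r - 1)"
        using r by (simp flip: power_Suc)
      ultimately show ?thesis by (metis mult.left_commute)
    qed
    finally show "of_nat r * fps_compose (log_deriv ?U) (fps_X ^ r) * fps_compose ?U (fps_X ^ r)
      = fps_X * fps_deriv (fps_compose ?U (fps_X ^ r))"
      by (simp add: fps_compose_deriv[OF r0] mult_ac)
  qed simp
  hence "fps_nth (log_deriv (fps_compose (qcat 1) (fps_X ^ r))) (r * n)
    = of_nat r * fps_nth (log_deriv (qcat (1::'a))) n"
    using r by (simp add: fps_nth_compose_X_power flip: fps_of_nat)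
  with 1 r show ?thesis by (simp add: qcat_orbit_prod)
qed

end

section \<open>Divisibility of the Moebius trace of the q-Catalan series\<close>

lemma int_eval_moebius_trace_qcat:
  "int_eval a (moebius_trace m (qcat [:0, 1:]))
    = (\<Sum>e | e dvd m. of_int (moebius_int e) * fps_nth (log_deriv (qcat (a ^ e))) (m div e))"
proof -
  have "int_eval a (int_eval (monom 1 e) (fps_nth (log_deriv (qcat [:0, 1:])) n))
      = fps_nth (log_deriv (qcat (a ^ e))) n" for e n
    by (simp add: ring_morphism_comp_int_eval[OF ring_morphism_int_eval]
        log_deriv_qcat_morphism[OF ring_morphism_int_eval])
  thus ?thesis by (simp add: moebius_trace_def int_eval_sum)
qed

text \<open>
  Let $r$ be the order of $z$. The power $z^e$ has order $r/\gcd(e, r)$, and dividing $m/e$ by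
  this order leaves $m/\mathrm{lcm}(e, r)$. So the $e$-th summand is $\mu(e)$ times a function of
  $\mathrm{lcm}(e, r)$, which does not change when $e$ is multiplied by a prime factor of $r$ that
  does not divide $e$.
\<close>

lemma int_eval_moebius_trace_qcat_root_of_unity:
  fixes z :: "'a::field_char_0"
  assumes "z ^ m = 1" "z \<noteq> 1" "m > 0"
  shows "int_eval z (moebius_trace m (qcat [:0, 1:])) = 0"
proof -
  obtain r where r: "primitive_root_of_unity r z"
    using exists_primitive_root_of_unity assms by blast
  hence r0: "r > 0" and iff: "z ^ n = 1 \<longleftrightarrow> r dvd n" for n
    by (auto simp: primitive_root_of_unity_def)
  have rm: "r dvd m" and r1: "r \<noteq> 1"
    using iff[of m] iff[of 1] assms by auto
  from r1 obtain p where p: "prime p" "p dvd r" using prime_factor_nat by blast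
  define f where "f e = fps_nth (log_deriv (qcat (z ^ e))) (m div e)" for e
  have f: "f e = fps_nth (log_deriv (qcat 1)) (m div lcm e r)" if e: "e dvd m" for e
  proof -
    have e0: "e > 0" using e assms(3) by (auto intro: Nat.gr0I)
    have lcm: "lcm e r = e * (r div gcd e r)"
      by (metis div_mult_swap gcd_dvd2 lcm_nat_def)
    have lcm_dvd: "lcm e r dvd m" using e rm by (rule lcm_least)
    then obtain j where j: "m = lcm e r * j" by (rule dvdE)
    have "lcm e r > 0" using e0 r0 by (simp add: lcm_pos_nat)
    hence "m div lcm e r = j" "m div e = (r div gcd e r) * j"
      using e0 by (simp_all add: j) (simp add: lcm mult.assoc)
    thus ?thesis
      using log_deriv_qcat_primitive_root[OF primitive_root_of_unity_power[OF r e0], of j]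
      by (simp add: f_def)
  qed
  have "(\<Sum>e | e dvd m. of_int (moebius_int e) * f e) = 0"
  proof (rule moebius_sum_eq_0[of p])
    fix e assume e: "e dvd m" "\<not> p dvd e"
    have pm: "p dvd m" using p(2) rm by (rule dvd_trans)
    have cop: "coprime p e" using p(1) e(2) by (rule prime_imp_coprime)
    hence "p * e dvd m" using pm e(1) by (intro divides_mult)
    moreover have "lcm (p * e) r = lcm e r"
    proof (rule dvd_antisym)
      have "p * e dvd lcm e r"
        using cop p(2) by (intro divides_mult) (auto intro: dvd_trans[of p r])
      thus "lcm (p * e) r dvd lcm e r" by (intro lcm_least) auto
      show "lcm e r dvd lcm (p * e) r" by (intro lcm_least) (auto intro: dvd_trans[of e "p * e"])
    qed
    ultimately show "f (p * e) = f e" using e by (simp add: f)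
  qed (use p rm assms(3) in \<open>auto intro: dvd_trans\<close>)
  thus ?thesis by (simp add: int_eval_moebius_trace_qcat f_def)
qed

lemma int_poly_eq_0_if_many_complex_roots:
  assumes "finite A" "\<And>z :: complex. z \<in> A \<Longrightarrow> int_eval z p = 0" "p \<noteq> 0 \<Longrightarrow> degree p < card A"
  shows "p = 0"
proof (rule ccontr)
  assume p: "p \<noteq> 0"
  let ?p = "map_poly of_int p :: complex poly"
  have deg: "degree ?p = degree p" by (intro degree_map_poly) auto
  have p': "?p \<noteq> 0" using p by (simp add: map_poly_eq_0_iff)
  have "A \<subseteq> {z. poly ?p z = 0}" using assms(2) by (auto simp: int_eval_def)
  hence "card A \<le> card {z. poly ?p z = 0}"
    using p' by (intro card_mono poly_roots_finite)
  also have "\<dots> \<le> degree ?p" using p' by (rule card_poly_roots_bound)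
  finally show False using assms(3)[OF p] deg by simp
qed

text \<open>
  Division by a monic polynomial stays within the integer polynomials, and the remainder has too
  many complex roots not to vanish.
\<close>

lemma monic_dvd_if_complex_roots:
  fixes L P :: "int poly"
  assumes "lead_coeff P = 1" "finite A" "card A = degree P"
    "\<And>z :: complex. z \<in> A \<Longrightarrow> int_eval z L = 0" "\<And>z :: complex. z \<in> A \<Longrightarrow> int_eval z P = 0"
  shows "P dvd L"
proof -
  have P: "P \<noteq> 0" using assms(1) by auto
  obtain D R where DR: "pseudo_divmod L P = (D, R)" by fastforce
  have eq: "L = P * D + R" and deg: "R = 0 \<or> degree R < degree P"
    using pseudo_divmod[OF P DR] by (simp_all add: assms(1))
  have "R = 0"
  proof (rule int_poly_eq_0_if_many_complex_roots[of A])
    fix z :: complex assume "z \<in> A"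
    thus "int_eval z R = 0" using arg_cong[OF eq, of "int_eval z"] by (simp add: assms)
  qed (use assms deg in auto)
  thus ?thesis by (simp add: eq)
qed

lemma moebius_trace_qcat_factorization:
  assumes "m > 0"
  obtains D where "moebius_trace m (qcat [:0, 1:]) = of_nat m * ((\<Sum>i<m. monom 1 i) * D)"
proof -
  define P :: "int poly" where "P = (\<Sum>i<m. monom 1 i)"
  obtain L where L: "moebius_trace m (qcat [:0, 1:]) = of_nat m * L"
    using dvd_moebius_trace[OF assms, of "qcat [:0, 1:]"] by (auto simp: dvd_def)
  have coeff_P: "coeff P i = (if i < m then 1 else 0)" for i
    by (simp add: P_def coeff_sum)
  have deg: "degree P = m - 1"
  proof (rule antisym)
    show "degree P \<le> m - 1" using assms by (intro degree_le) (auto simp: coeff_P)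
    show "m - 1 \<le> degree P" using assms by (intro le_degree) (simp add: coeff_P)
  qed
  define A where "A = {z :: complex. z ^ m = 1} - {1}"
  have fin: "finite {z :: complex. z ^ m = 1}"
    using card_roots_unity_eq[OF assms] assms by (intro card_ge_0_finite) simp
  have "P dvd L"
  proof (rule monic_dvd_if_complex_roots[of _ A])
    show "lead_coeff P = 1" using assms by (simp add: deg coeff_P)
    show "finite A" using fin by (simp add: A_def)
    show "card A = degree P"
      using fin card_roots_unity_eq[OF assms] by (simp add: A_def deg card_Diff_singleton)
    fix z assume z: "z \<in> A"
    have "of_nat m * int_eval z L = int_eval z (moebius_trace m (qcat [:0, 1:]))"
      by (simp add: L)
    also have "\<dots> = 0"
      using z assms by (intro int_eval_moebius_trace_qcat_root_of_unity) (auto simp: A_def)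
    finally show "int_eval z L = 0" using assms by simp
    have "(z - 1) * (\<Sum>i<m. z ^ i) = 0"
      using z by (simp add: A_def flip: power_diff_1_eq)
    thus "int_eval z P = 0" using z by (simp add: P_def int_eval_sum A_def)
  qed
  thus ?thesis using that L by (auto simp: P_def dvd_def)
qed

section \<open>Adams operations on rational functions\<close>

lemma to_fract_power: "to_fract (a ^ n) = to_fract a ^ n"
  by (induction n) simp_all

lemma ring_morphism_to_fract: "ring_morphism to_fract"
  by (simp add: ring_morphism_def)

lemma ring_morphism_pcompose: "ring_morphism (\<lambda>p. pcompose p r)"
  by (simp add: ring_morphism_def pcompose_add pcompose_mult pcompose_1)

lemma monom_1_eq_power: "monom 1 n = [:0, 1:] ^ n"
  by (simp add: monom_altdef)

lemma pcompose_monom_1: "pcompose (monom (1::'a::comm_ring_1) n) r = r ^ n"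
proof -
  have "pcompose (monom 1 n) r = pcompose ([:0, 1:] ^ n) r"
    by (simp only: monom_1_eq_power)
  also have "\<dots> = pcompose [:0, 1:] r ^ n"
    by (rule ring_morphism_power[OF ring_morphism_pcompose])
  finally show ?thesis by (simp add: pcompose_pCons)
qed

lemma qhalf_power: "qhalf ^ n = to_fract (monom 1 n)"
  by (simp add: qhalf_def monom_1_eq_power to_fract_power)

lemma q_power: "q ^ n = to_fract (monom 1 (2 * n))"
  by (simp only: q_def flip: qhalf_power power_mult)

lemma q_power_neq_1: "n > 0 \<Longrightarrow> q ^ n \<noteq> 1"
  by (metis degree_1 degree_monom_eq mult_eq_0_iff neq0_conv one_neq_zero q_power to_fract_1 to_fract_eq_iff
      zero_neq_numeral)

lemma qhalf_nonzero: "qhalf \<noteq> 0"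
  by (simp add: qhalf_def)

text \<open>
  Two representations of a fraction are related by a polynomial identity after cross-multiplication,
  which the substitution preserves; for $d > 0$ it also keeps the denominators nonzero.
\<close>

lemma adams_coeff_fract:
  assumes "d > 0" "b \<noteq> 0"
  shows "adams_coeff d (to_fract a / to_fract b)
    = to_fract (pcompose a (monom 1 d)) / to_fract (pcompose b (monom 1 d))"
proof -
  let ?r = "to_fract a / to_fract b"
  obtain a' b' where ab: "quot_of_fract ?r = (a', b')" by fastforce
  have b': "b' \<noteq> 0" using snd_quot_of_fract_nonzero[of ?r] by (simp add: ab)
  have nz: "pcompose c (monom 1 d) \<noteq> 0" if "c \<noteq> 0" for c :: "rat poly"
    using that assms pcompose_eq_0[of c "monom 1 d"] by (auto simp: degree_monom_eq)
  have "to_fract a' / to_fract b' = ?r"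
    using Fract_quot_of_fract[of ?r] by (simp add: ab Fract_conv_to_fract)
  hence "to_fract (a' * b) = to_fract (a * b')"
    using b' assms by (simp add: field_simps)
  hence "a' * b = a * b'" by (simp only: to_fract_eq_iff)
  hence "pcompose a' (monom 1 d) * pcompose b (monom 1 d)
      = pcompose a (monom 1 d) * pcompose b' (monom 1 d)"
    by (simp flip: pcompose_mult)
  hence "to_fract (pcompose a' (monom 1 d)) * to_fract (pcompose b (monom 1 d))
      = to_fract (pcompose a (monom 1 d)) * to_fract (pcompose b' (monom 1 d))"
    by (simp flip: to_fract_mult)
  thus ?thesis
    using nz[OF b'] nz[OF assms(2)] by (simp add: adams_coeff_def ab field_simps)
qed

lemma adams_coeff_to_fract:
  "d > 0 \<Longrightarrow> adams_coeff d (to_fract a) = to_fract (pcompose a (monom 1 d))"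
  using adams_coeff_fract[of d 1 a] by (simp add: pcompose_1)

lemma adams_coeff_mult_to_fract:
  assumes "d > 0"
  shows "adams_coeff d (to_fract a * r) = to_fract (pcompose a (monom 1 d)) * adams_coeff d r"
proof -
  obtain b c where bc: "quot_of_fract r = (b, c)" by fastforce
  have c: "c \<noteq> 0" using snd_quot_of_fract_nonzero[of r] by (simp add: bc)
  have r: "r = to_fract b / to_fract c"
    using Fract_quot_of_fract[of r] by (simp add: bc Fract_conv_to_fract)
  have "adams_coeff d (to_fract a * r) = adams_coeff d (to_fract (a * b) / to_fract c)"
    by (simp add: r)
  thus ?thesis
    unfolding adams_coeff_fract[OF assms c] by (simp add: r adams_coeff_fract[OF assms c] pcompose_mult)
qed

section \<open>The series and its plethystic logarithm\<close>

text \<open>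
  Obtained by replacing $x$ by $x/q$ in the Rogers--Ramanujan series
  $\sum_n q^{n^2} x^n / ((1-q)\cdots(1-q^n))$.
\<close>

definition rogers_ramanujan_series :: "ratfun fps" where
  "rogers_ramanujan_series = Abs_fps (\<lambda>n. q ^ (n * (n - 1)) / (\<Prod>i=1..n. 1 - q ^ i))"

lemma rogers_ramanujan_series_nth_0 [simp]: "fps_nth rogers_ramanujan_series 0 = 1"
  by (simp add: rogers_ramanujan_series_def)

lemma Z_series_eq_scale: "Z_series = fps_scale qhalf rogers_ramanujan_series"
proof (rule fps_ext)
  fix n
  have "n * (n - 1) + n ^ 2 = n + 2 * (n * (n - (1::nat)))"
    by (cases n) (simp_all add: power2_eq_square algebra_simps)
  hence "qhalf ^ (n * (n - 1) + n ^ 2) = qhalf ^ n * q ^ (n * (n - 1))"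
    by (simp only: q_def power_add flip: power_mult)
  thus "fps_nth Z_series n = fps_nth (fps_scale qhalf rogers_ramanujan_series) n"
    by (simp add: Z_series_def rogers_ramanujan_series_def)
qed

lemma rogers_ramanujan_series_q_difference: "rogers_ramanujan_series - fps_scale q rogers_ramanujan_series = fps_X * fps_scale (q ^ 2) rogers_ramanujan_series"
proof (rule fps_ext)
  fix n
  show "fps_nth (rogers_ramanujan_series - fps_scale q rogers_ramanujan_series) n = fps_nth (fps_X * fps_scale (q ^ 2) rogers_ramanujan_series) n"
  proof (cases n)
    case (Suc k)
    have "Suc k * k = 2 * k + k * (k - 1)"
      by (cases k) (simp_all add: algebra_simps)
    hence exp: "q ^ (Suc k * k) = (q ^ 2) ^ k * q ^ (k * (k - 1))"
      by (simp only: power_add power_mult)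
    have "fps_nth (rogers_ramanujan_series - fps_scale q rogers_ramanujan_series) n = (1 - q ^ Suc k) * fps_nth rogers_ramanujan_series (Suc k)"
      by (simp add: Suc algebra_simps)
    also have "\<dots> = q ^ (Suc k * k) / (\<Prod>i=1..k. 1 - q ^ i)"
      using q_power_neq_1[of "Suc k"] by (simp add: rogers_ramanujan_series_def prod.cl_ivl_Suc del: power_Suc)
    also have "\<dots> = fps_nth (fps_X * fps_scale (q ^ 2) rogers_ramanujan_series) n"
      unfolding exp by (simp add: Suc rogers_ramanujan_series_def)
    finally show ?thesis .
  qed simp
qed

text \<open>
  Dividing the $q$-difference equation by $G(x)$ gives $1 - U(x) = x\,U(x)\,U(qx)$ for
  $U(x) = G(qx)/G(x)$.
\<close>

lemma fps_scale_rogers_ramanujan_series: "fps_scale q rogers_ramanujan_series = qcat q * rogers_ramanujan_series"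
proof -
  define U where "U = fps_scale q rogers_ramanujan_series * inverse rogers_ramanujan_series"
  have UG: "U * rogers_ramanujan_series = fps_scale q rogers_ramanujan_series"
    by (simp add: U_def mult.assoc inverse_mult_eq_1)
  have "fps_scale q U * (U * rogers_ramanujan_series) = fps_scale q (U * rogers_ramanujan_series)"
    unfolding fps_scale_mult by (simp only: UG)
  hence U2: "fps_scale q U * (U * rogers_ramanujan_series) = fps_scale (q ^ 2) rogers_ramanujan_series"
    unfolding UG by (simp only: fps_scale_scale power2_eq_square)
  have "(1 - fps_X * (U * fps_scale q U)) * rogers_ramanujan_series
      = rogers_ramanujan_series - fps_X * (fps_scale q U * (U * rogers_ramanujan_series))"
    by (simp add: algebra_simps)
  also have "\<dots> = U * rogers_ramanujan_series"
    unfolding U2 unfolding UG by (simp flip: rogers_ramanujan_series_q_difference)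
  finally have "(U - (1 - fps_X * (U * fps_scale q U))) * rogers_ramanujan_series = 0"
    by (simp add: algebra_simps)
  moreover have "rogers_ramanujan_series \<noteq> 0" by (metis rogers_ramanujan_series_nth_0 fps_zero_nth zero_neq_one)
  ultimately have "U - (1 - fps_X * (U * fps_scale q U)) = 0" by (metis mult_eq_0_iff)
  hence "U = qcat q" by (intro qcat_unique) (rule eq_iff_diff_eq_0[THEN iffD2])
  with UG show ?thesis by simp
qed

lemma log_deriv_rogers_ramanujan_series:
  "(q ^ n - 1) * fps_nth (log_deriv rogers_ramanujan_series) n = fps_nth (log_deriv (qcat q)) n"
proof -
  have "log_deriv (fps_scale q rogers_ramanujan_series) = log_deriv (qcat q) + log_deriv rogers_ramanujan_series"
    by (simp add: fps_scale_rogers_ramanujan_series log_deriv_mult)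
  hence "fps_nth (log_deriv (fps_scale q rogers_ramanujan_series)) n
      = fps_nth (log_deriv (qcat q) + log_deriv rogers_ramanujan_series) n" by simp
  thus ?thesis by (simp add: log_deriv_scale algebra_simps)
qed

lemma fps_log_nth_times:
  assumes "fps_nth F 0 = 1"
  shows "of_nat n * fps_nth (fps_log F) n = fps_nth (log_deriv F) n"
proof -
  have F0: "fps_nth (F - 1) 0 = 0" using assms by simp
  have "fps_deriv (fps_log F) = fps_compose (inverse (1 + fps_X)) (F - 1) * fps_deriv F"
    unfolding fps_log_def by (subst fps_compose_deriv[OF F0]) (simp add: fps_ln_deriv)
  also have "fps_compose (inverse (1 + fps_X)) (F - 1) = inverse F"
    using F0 by (subst fps_inverse_compose) (simp_all add: fps_compose_add_distrib)
  finally have "log_deriv F = fps_X * fps_deriv (fps_log F)"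
    using assms inverse_mult_eq_1[of F]
    by (intro log_deriv_eqI) (simp_all add: mult_ac)
  thus ?thesis by (cases n) simp_all
qed

text \<open>
  Let $F(x) = G(q^{1/2}x)$ be the given series. For $e = 1$ the claim combines
  $T(F)_n = q^{n/2}\,T(G)_n$, $n [x^n] \log F = T(F)_n$ with $(q^n - 1) T(G)_n = T(U)_n$. Applying
  $\Psi_e$ gives the general case, where the factor depends on $e$ and $n$ only through $en$.
\<close>

lemma adams_coeff_log_Z_series:
  assumes "e > 0"
  shows "(q ^ (e * n) - 1) * (of_nat n * adams_coeff e (fps_nth (fps_log Z_series) n))
    = qhalf ^ (e * n) * fps_nth (log_deriv (qcat (q ^ e))) n"
proof -
  define l where "l = fps_nth (fps_log Z_series) n"
  define t where "t = fps_nth (log_deriv (qcat [:0, 1::int:])) n"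
  define P where "P j = int_eval (monom (1::rat) (2 * j)) t" for j
  have P: "to_fract (P j) = fps_nth (log_deriv (qcat (q ^ j))) n" for j
  proof -
    have "to_fract (P j) = int_eval (q ^ j) t"
      by (simp add: P_def ring_morphism_comp_int_eval[OF ring_morphism_to_fract] q_power)
    thus ?thesis by (simp add: t_def log_deriv_qcat_morphism[OF ring_morphism_int_eval])
  qed
  have "to_fract ((monom 1 (2 * n) - 1) * of_nat n) * l = (q ^ n - 1) * (of_nat n * l)"
    by (simp add: q_power ring_morphism_of_nat[OF ring_morphism_to_fract])
  also have "of_nat n * l = qhalf ^ n * fps_nth (log_deriv rogers_ramanujan_series) n"
    unfolding l_def by (subst fps_log_nth_times) (simp_all add: Z_series_eq_scale log_deriv_scale)
  also have "(q ^ n - 1) * \<dots> = qhalf ^ n * fps_nth (log_deriv (qcat q)) n"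
    by (simp add: log_deriv_rogers_ramanujan_series[symmetric])
  also have "\<dots> = to_fract (monom 1 n * P 1)"
    using P[of 1] by (simp add: qhalf_power)
  finally have "adams_coeff e (to_fract ((monom 1 (2 * n) - 1) * of_nat n) * l)
      = adams_coeff e (to_fract (monom 1 n * P 1))" by simp
  hence "to_fract (pcompose ((monom 1 (2 * n) - 1) * of_nat n) (monom 1 e)) * adams_coeff e l
      = to_fract (pcompose (monom 1 n * P 1) (monom 1 e))"
    unfolding adams_coeff_mult_to_fract[OF assms] adams_coeff_to_fract[OF assms] .
  moreover have "pcompose ((monom 1 (2 * n) - 1) * of_nat n) (monom 1 e)
      = (monom 1 (2 * (e * n)) - 1) * (of_nat n :: rat poly)"
    by (simp add: pcompose_mult pcompose_diff pcompose_1 pcompose_monom_1 monom_power mult_ac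
        ring_morphism_of_nat[OF ring_morphism_pcompose])
  moreover have "pcompose (monom 1 n * P 1) (monom 1 e) = monom 1 (e * n) * P e"
    by (simp add: P_def pcompose_mult pcompose_monom_1 monom_power mult_ac
        ring_morphism_comp_int_eval[OF ring_morphism_pcompose])
  ultimately show ?thesis
    by (simp add: P qhalf_power q_power l_def mult_ac ring_morphism_of_nat[OF ring_morphism_to_fract])
qed

text \<open>
  All summands $e \mid m$ of the plethystic logarithm acquire the same factors $q^m - 1$ and
  $q^{m/2}$, which leaves the Moebius trace of an integral series.
\<close>

lemma plethystic_Log_Z_series:
  assumes "m > 0"
  shows "of_nat m * (q ^ m - 1) * fps_nth (plethystic_Log Z_series) m
    = qhalf ^ m * int_eval q (moebius_trace m (qcat [:0, 1:]))"
proof -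
  let ?l = "\<lambda>n. fps_nth (fps_log Z_series) n"
  have "fps_nth (plethystic_Log Z_series) m
      = (\<Sum>e\<in>{1..m}. if e dvd m then of_rat (moebius_mu e / of_nat e) * adams_coeff e (?l (m div e)) else 0)"
    unfolding plethystic_Log_def adams_def fps_nth_Abs_fps by (intro sum.cong) auto
  also have "\<dots> = (\<Sum>e | e dvd m. of_rat (moebius_mu e / of_nat e) * adams_coeff e (?l (m div e)))"
    using assms by (intro sum.mono_neutral_cong_right)
      (auto dest: dvd_imp_le intro: Nat.gr0I simp: Suc_le_eq)
  finally have "of_nat m * (q ^ m - 1) * fps_nth (plethystic_Log Z_series) m
      = (\<Sum>e | e dvd m. of_nat m * (q ^ m - 1)
          * (of_rat (moebius_mu e / of_nat e) * adams_coeff e (?l (m div e))))"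
    by (simp add: sum_distrib_left)
  also have "\<dots> = (\<Sum>e | e dvd m. qhalf ^ m
      * (of_int (moebius_int e) * fps_nth (log_deriv (qcat (q ^ e))) (m div e)))"
  proof (intro sum.cong refl)
    fix e assume "e \<in> {e. e dvd m}"
    then obtain n where m: "m = e * n" by auto
    with assms have e: "e > 0" by auto
    have "of_nat m * (q ^ m - 1) * (of_rat (moebius_mu e / of_nat e) * adams_coeff e (?l (m div e)))
        = of_int (moebius_int e) * ((q ^ (e * n) - 1) * (of_nat n * adams_coeff e (?l n)))"
      using e by (simp add: m moebius_mu_eq of_rat_divide)
    thus "of_nat m * (q ^ m - 1) * (of_rat (moebius_mu e / of_nat e) * adams_coeff e (?l (m div e)))
        = qhalf ^ m * (of_int (moebius_int e) * fps_nth (log_deriv (qcat (q ^ e))) (m div e))"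
      using e by (simp add: adams_coeff_log_Z_series[OF e] m)
  qed
  finally show ?thesis
    by (simp add: int_eval_moebius_trace_qcat sum_distrib_left)
qed

theorem f1_eq_integer_polynomial:
  assumes "m > 0"
  obtains D where "f1 m = to_fract (monom 1 (m - 1) * int_eval (monom 1 2) D)"
proof -
  obtain D where D: "moebius_trace m (qcat [:0, 1:]) = of_nat m * ((\<Sum>i<m. monom 1 i) * D)"
    using moebius_trace_qcat_factorization[OF assms] .
  let ?L = "fps_nth (plethystic_Log Z_series) m"
  have eq: "of_nat m * (q ^ m - 1) * ?L = qhalf ^ m * (of_nat m * ((\<Sum>i<m. q ^ i) * int_eval q D))"
    by (simp add: plethystic_Log_Z_series[OF assms] D int_eval_sum)
  have "of_nat m * (q ^ m - 1) * ((q - 1) * ?L) = (q - 1) * (of_nat m * (q ^ m - 1) * ?L)"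
    by (simp only: mult_ac)
  also have "\<dots> = of_nat m * ((q - 1) * (\<Sum>i<m. q ^ i)) * (qhalf ^ m * int_eval q D)"
    unfolding eq by (simp only: mult_ac)
  also have "\<dots> = of_nat m * (q ^ m - 1) * (qhalf ^ m * int_eval q D)"
    by (simp only: power_diff_1_eq)
  finally have L: "(q - 1) * ?L = qhalf ^ m * int_eval q D"
    using q_power_neq_1[OF assms] assms by simp
  have "f1 m = inverse qhalf * ((q - 1) * ?L)"
    using qhalf_nonzero by (simp add: f1_def q_def field_simps power2_eq_square)
  also have "\<dots> = qhalf ^ (m - 1) * int_eval q D"
    unfolding L using assms qhalf_nonzero by (cases m) simp_all
  also have "\<dots> = to_fract (monom 1 (m - 1) * int_eval (monom 1 2) D)"
    using q_power[of 1]
    by (simp add: qhalf_power ring_morphism_comp_int_eval[OF ring_morphism_to_fract])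
  finally show ?thesis using that by blast
qed

section \<open>Values and coefficients of polynomials in the square root of q\<close>

lemma to_fract_const: "to_fract [:c:] = of_rat c"
proof (cases c)
  case (Fract a b)
  have int: "to_fract [:of_int k:] = of_int k" for k
    using ring_morphism_of_int[OF ring_morphism_to_fract, of k] by (metis of_int_poly)
  have "to_fract [:c:] * to_fract [:of_int b:] = to_fract [:of_int a:]"
    using Fract by (simp add: Fract_of_int_quotient flip: to_fract_mult)
  thus ?thesis
    using Fract by (simp add: int of_rat_rat field_simps)
qed

lemma to_fract_smult: "to_fract (smult c p) = of_rat c * to_fract p"
  using to_fract_mult[of "[:c:]" p] by (simp add: to_fract_const)

lemma sum_support_coeff:
  assumes "\<And>n. h n 0 = (0::'a::comm_monoid_add)"
  shows "(\<Sum>n | coeff p n \<noteq> 0. h n (coeff p n)) = (\<Sum>n\<le>degree p. h n (coeff p n))"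
  by (intro sum.mono_neutral_left) (auto simp: assms le_degree)

lemma to_fract_pcompose_eq_sum:
  fixes p r :: "rat poly"
  shows "to_fract (pcompose p r) = (\<Sum>n | coeff p n \<noteq> 0. of_rat (coeff p n) * to_fract r ^ n)"
proof -
  have "to_fract (pcompose p r) = (\<Sum>n\<le>degree p. to_fract (pcompose (monom (coeff p n) n) r))"
    by (subst poly_as_sum_of_monoms[of p, symmetric]) (simp add: pcompose_sum)
  also have "\<dots> = (\<Sum>n\<le>degree p. of_rat (coeff p n) * to_fract r ^ n)"
  proof (intro sum.cong refl)
    fix n
    have "monom (coeff p n) n = smult (coeff p n) (monom 1 n)" by (simp add: smult_monom)
    thus "to_fract (pcompose (monom (coeff p n) n) r) = of_rat (coeff p n) * to_fract r ^ n"
      by (simp add: pcompose_smult pcompose_monom_1 to_fract_power to_fract_smult)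
  qed
  finally show ?thesis
    by (simp add: sum_support_coeff[of "\<lambda>n c. of_rat c * to_fract r ^ n"])
qed

lemma value_at_to_fract: "value_at (to_fract p) a = poly p a"
  by (simp add: value_at_def)

lemma regular_at_to_fract: "regular_at (to_fract p) a"
  by (simp add: regular_at_def)

lemma laurent_expansion_to_fract:
  "fls_nth (laurent_expansion (to_fract p)) k = (if k \<ge> 0 then coeff p (nat k) else 0)"
  by (simp add: laurent_expansion_def)

theorem corollary1p7:
  fixes m :: nat
  assumes "m \<ge> 1"
  shows "finite {k. N1 m k \<noteq> 0} \<and>
    f1 m = (\<Sum>k | N1 m k \<noteq> 0. of_rat (N1 m k) * qhalf powi k) \<and>
    regular_at (f1 m) 1 \<and>
    regular_at (g m) 1 \<and>
    value_at (g m) 1 = (\<Sum>k | nmk m k \<noteq> 0. nmk m k) \<and>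
    (\<Sum>k | nmk m k \<noteq> 0. nmk m k) = (- 1) ^ m * value_at (f1 m) 1 \<and>
    (- 1) ^ m * value_at (f1 m) 1 \<in> \<int>"
proof -
  obtain D where D: "f1 m = to_fract (monom 1 (m - 1) * int_eval (monom 1 2) D)"
    using f1_eq_integer_polynomial[of m] assms by auto
  define p where "p = monom (1::rat) (m - 1) * int_eval (monom 1 2) D"
  have f1: "f1 m = to_fract p" by (simp add: D p_def)
  have N1: "N1 m k = (if k \<ge> 0 then coeff p (nat k) else 0)" for k
    by (simp add: N1_def f1 laurent_expansion_to_fract)
  let ?A = "{n. coeff p n \<noteq> 0}"
  have supp: "{k. N1 m k \<noteq> 0} = int ` ?A"
    by (auto simp: N1 image_iff intro!: exI[of _ "nat _"])
  have supp': "{k. nmk m k \<noteq> 0} = int ` ?A"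
    by (simp add: nmk_def flip: supp)
  have fin: "finite ?A"
    by (rule finite_subset[of _ "{..degree p}"]) (auto simp: le_degree)
  have "poly p 1 = poly (int_eval (monom 1 2) D) 1"
    by (simp add: p_def poly_monom)
  also have "\<dots> = of_int (poly D 1)"
  proof -
    have "ring_morphism (\<lambda>p. poly p (1::rat))" by (simp add: ring_morphism_def)
    hence "poly (int_eval (monom 1 2) D) 1 = int_eval (1::rat) D"
      using ring_morphism_comp_int_eval[of "\<lambda>p. poly p 1" "monom 1 2" D] by (simp add: poly_monom)
    also have "ring_morphism (of_int :: int \<Rightarrow> rat)" by (simp add: ring_morphism_def)
    from ring_morphism_comp_int_eval[OF this, of 1 D] have "int_eval (1::rat) D = of_int (poly D 1)"
      by (simp add: int_eval_eq_poly)
    finally show ?thesis .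
  qed
  finally have int: "poly p 1 \<in> \<int>" by simp
  have f1_sum: "f1 m = (\<Sum>k | N1 m k \<noteq> 0. of_rat (N1 m k) * qhalf powi k)"
    using to_fract_pcompose_eq_sum[of p "[:0, 1:]"]
    unfolding supp by (subst sum.reindex) (simp_all add: f1 N1 qhalf_def)
  have g: "g m = to_fract (smult ((- 1) ^ m) (pcompose p (monom 1 2)))"
  proof -
    have "g m = (\<Sum>n\<in>?A. of_rat ((- 1) ^ m * coeff p n) * q ^ n)"
      unfolding g_def supp' by (subst sum.reindex) (simp_all add: nmk_def N1)
    also have "\<dots> = of_rat ((- 1) ^ m) * (\<Sum>n\<in>?A. of_rat (coeff p n) * q ^ n)"
      by (simp add: sum_distrib_left of_rat_mult mult_ac)
    also have "\<dots> = of_rat ((- 1) ^ m) * to_fract (pcompose p (monom 1 2))"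
      using q_power[of 1] by (simp add: to_fract_pcompose_eq_sum)
    finally show ?thesis by (simp add: to_fract_smult)
  qed
  have sum_nmk: "(\<Sum>k | nmk m k \<noteq> 0. nmk m k) = (- 1) ^ m * poly p 1"
  proof -
    have "(\<Sum>k | nmk m k \<noteq> 0. nmk m k) = (- 1) ^ m * (\<Sum>n\<in>?A. coeff p n)"
      unfolding supp' by (subst sum.reindex) (simp_all add: nmk_def N1 sum_distrib_left)
    thus ?thesis by (simp add: sum_support_coeff[of "\<lambda>_ x. x"] poly_altdef)
  qed
  have fin_N1: "finite {k. N1 m k \<noteq> 0}"
    unfolding supp using fin by simp
  have f1_at_1: "regular_at (f1 m) 1" "value_at (f1 m) 1 = poly p 1"
    by (simp_all add: f1 value_at_to_fract regular_at_to_fract)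
  have g_at_1: "regular_at (g m) 1" "value_at (g m) 1 = (- 1) ^ m * poly p 1"
    by (simp_all add: g value_at_to_fract regular_at_to_fract poly_pcompose poly_monom)
  have "(- 1) ^ m * poly p 1 \<in> \<int>" using int by simp
  thus ?thesis
    unfolding f1_at_1(2) g_at_1(2) sum_nmk
    by (intro conjI fin_N1 f1_sum f1_at_1(1) g_at_1(1) refl)
qed

end
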